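(* Let $G=\mathrm{Isom}_e\mathrm{Nil}=\mathrm{Nil}\rtimes\mathrm{SO}(2)$, let $M$ be a connected closed oriented $3$-manifold, let $\rho\colon\pi_1(M)\to G$ be a representation such that $P_\rho$ is trivial, and let $\omega_{\mathrm{triv}}^s$ be the trivial connection determined by a section $s\colon M\to P_\rho$. For any flat connection $\omega_{\mathrm{flat}}$ on $P_\rho$, write $a=\omega_{\mathrm{flat}}-\omega_{\mathrm{triv}}^s=a_XX+a_YY+a_ZZ+a_RR$ with respect to the trivialization given by $s$ (so $a_X,a_Y,a_Z,a_R$ are real $1$-forms on $M$). Then, for the invariant polynomial $p=p_{c_1,c_2}$ with any $c_1,c_2\in\mathbb R$, $$\mathrm{CS}_p(\omega_{\mathrm{flat}},\omega_{\mathrm{triv}}^s)=c_1\,d(a_Z\wedge a_R)\in\mathcal A^3(M;\mathbb R).$$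
   Context: Manifolds, bundles and maps are smooth. $\mathcal A^3(M;\mathbb R)$ denotes real $3$-forms on $M$. $P_\rho=\widetilde M\times_\rho G$ is the flat principal bundle of $\rho$. $\omega_{\mathrm{triv}}^s$ is the unique flat connection with $s^*\omega_{\mathrm{triv}}^s=0$. $\mathrm{Nil}$ is the $3$-dimensional Heisenberg group; $\mathfrak g=\mathrm{Lie}(G)$ has basis $X,Y,Z,R$ ($X,Y,Z$ spanning the Heisenberg algebra, $R$ generating $\mathfrak{so}(2)$) with nontrivial brackets $[X,Y]=Z$, $[R,X]=Y$, $[R,Y]=-X$. $p_{c_1,c_2}=\langle\cdot,\cdot\rangle$ is the $\mathrm{Ad}(G)$-invariant symmetric bilinear form whose only possibly nonzero components are $\langle X,X\rangle=\langle Y,Y\rangle=\langle Z,R\rangle=c_1$, $\langle R,R\rangle=c_2$. For $\mathfrak g$-valued forms, $[\alpha\otimes\xi,\beta\otimes\eta]=(\alpha\wedge\beta)\otimes[\xi,\eta]$ and $\langle\alpha\otimes\xi,\beta\otimes\eta\rangle=(\alpha\wedge\beta)\langle\xi,\eta\rangle$. For connections $\omega_1,\omega_0$ with $a=\omega_1-\omega_0$ (an $\mathrm{ad}P$-valued $1$-form on $M$), $\Omega_0=d\omega_0+\frac12[\omega_0,\omega_0]$, $d_{\omega_0}a=da+[\omega_0,a]$, the relative Chern--Simons form is $\mathrm{CS}_p(\omega_1,\omega_0)=\langle a,d_{\omega_0}a\rangle+\frac13\langle a,[a,a]\rangle+2\langle a,\Omega_0\rangle$. *)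

theory Defs
  imports "HOL-Analysis.Analysis" "HOL-Algebra.Group"
begin

section \<open>Smooth manifolds, given by atlases\<close>

text \<open>For open \<open>S\<close>, \<open>C_infinity_on S f\<close> says that \<open>f\<close> is infinitely often differentiable on \<open>S\<close>.\<close>

primrec C_on :: "nat \<Rightarrow> 'a::euclidean_space set \<Rightarrow> ('a \<Rightarrow> 'b::real_normed_vector) \<Rightarrow> bool" where
  "C_on 0 S f \<longleftrightarrow> continuous_on S f"
| "C_on (Suc k) S f \<longleftrightarrow>
     (\<forall>x\<in>S. f differentiable (at x)) \<and> (\<forall>v. C_on k S (\<lambda>x. frechet_derivative f (at x) v))"

definition C_infinity_on :: "'a::euclidean_space set \<Rightarrow> ('a \<Rightarrow> 'b::real_normed_vector) \<Rightarrow> bool" where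
  "C_infinity_on S f \<longleftrightarrow> (\<forall>k. C_on k S f)"

type_synonym ('m, 'e) chart = "'m set \<times> ('m \<Rightarrow> 'e)"

definition local_rep :: "('m, 'e) chart \<Rightarrow> ('n, 'f) chart \<Rightarrow> ('m \<Rightarrow> 'n) \<Rightarrow> 'e \<Rightarrow> 'f" where
  "local_rep c d f = snd d \<circ> f \<circ> the_inv_into (fst c) (snd c)"

text \<open>The differential of \<open>f\<close> at the point \<open>x\<close>, in the coordinates \<open>c\<close> and \<open>d\<close>.\<close>

definition coord_deriv ::
    "('m, 'e::euclidean_space) chart \<Rightarrow> ('n, 'f::euclidean_space) chart \<Rightarrow> ('m \<Rightarrow> 'n) \<Rightarrow> 'm \<Rightarrow> 'e \<Rightarrow> 'f" where
  "coord_deriv c d f x = frechet_derivative (local_rep c d f) (at (snd c x))"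

definition smooth_manifold :: "('m::topological_space, 'e::euclidean_space) chart set \<Rightarrow> bool" where
  "smooth_manifold A \<longleftrightarrow>
     (\<Union>c\<in>A. fst c) = UNIV \<and>
     (\<forall>c\<in>A. open (fst c) \<and> open (snd c ` fst c) \<and>
        homeomorphism (fst c) (snd c ` fst c) (snd c) (the_inv_into (fst c) (snd c))) \<and>
     (\<forall>c\<in>A. \<forall>d\<in>A. C_infinity_on (snd c ` (fst c \<inter> fst d)) (local_rep c d id))"

text \<open>An orientation is given by an atlas whose coordinate changes all preserve the orientation
  of \<open>\<real>\<^sup>n\<close>.\<close>

definition oriented_atlas :: "('m, real ^ 'n) chart set \<Rightarrow> bool" where
  "oriented_atlas A \<longleftrightarrow>
     (\<forall>c\<in>A. \<forall>d\<in>A. \<forall>x\<in>fst c \<inter> fst d. 0 < det (matrix (coord_deriv c d id x)))"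

text \<open>Smoothness is required in all pairs of charts. Openness of the domains of the local
  representatives is the continuity of \<open>f\<close>, so that no topology beyond the one induced by the
  atlases is needed.\<close>

definition smooth_map ::
    "('m, 'e::euclidean_space) chart set \<Rightarrow> ('n, 'f::euclidean_space) chart set \<Rightarrow> ('m \<Rightarrow> 'n) \<Rightarrow> bool" where
  "smooth_map A B f \<longleftrightarrow>
     (\<forall>c\<in>A. \<forall>d\<in>B. open (snd c ` (fst c \<inter> f -` fst d)) \<and>
        C_infinity_on (snd c ` (fst c \<inter> f -` fst d)) (local_rep c d f))"

definition product_atlas :: "('m, 'e) chart set \<Rightarrow> ('n, 'f) chart set \<Rightarrow> ('m \<times> 'n, 'e \<times> 'f) chart set" where
  "product_atlas A B = {(U \<times> V, map_prod \<phi> \<psi>) |U \<phi> V \<psi>. (U, \<phi>) \<in> A \<and> (V, \<psi>) \<in> B}"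

text \<open>The atlas for which a quotient map \<open>q\<close> (by a free and properly discontinuous action) is a
  local diffeomorphism.\<close>

definition quotient_atlas :: "('m \<Rightarrow> 'n) \<Rightarrow> ('m, 'e) chart set \<Rightarrow> ('n, 'e) chart set" where
  "quotient_atlas q A = {(q ` W, \<phi> \<circ> the_inv_into W q) |W \<phi>. (W, \<phi>) \<in> A \<and> inj_on q W}"

section \<open>Differential forms\<close>

text \<open>A vector valued form is the family of its local representatives: one form on the coordinate
  domain \<open>snd c ` fst c\<close> for each chart \<open>c\<close> of the atlas, compatible with coordinate changes. The
  values of a representative outside of the coordinate domain are irrelevant.\<close>

type_synonym ('m, 'e, 'v) form1 = "('m, 'e) chart \<Rightarrow> 'e \<Rightarrow> 'e \<Rightarrow> 'v"
type_synonym ('m, 'e, 'v) form2 = "('m, 'e) chart \<Rightarrow> 'e \<Rightarrow> 'e \<Rightarrow> 'e \<Rightarrow> 'v"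
type_synonym ('m, 'e, 'v) form3 = "('m, 'e) chart \<Rightarrow> 'e \<Rightarrow> 'e \<Rightarrow> 'e \<Rightarrow> 'e \<Rightarrow> 'v"

text \<open>\<open>is_pullback1 A B f \<omega> \<tau>\<close> says \<open>f\<^sup>* \<omega> = \<tau>\<close>, where \<open>f\<close> maps the manifold with atlas \<open>A\<close> to the one
  with atlas \<open>B\<close>; likewise for 3-forms.\<close>

definition is_pullback1 ::
    "('m, 'e::euclidean_space) chart set \<Rightarrow> ('n, 'f::euclidean_space) chart set \<Rightarrow> ('m \<Rightarrow> 'n) \<Rightarrow>
     ('n, 'f, 'v) form1 \<Rightarrow> ('m, 'e, 'v) form1 \<Rightarrow> bool" where
  "is_pullback1 A B f \<omega> \<tau> \<longleftrightarrow>
     (\<forall>c\<in>A. \<forall>d\<in>B. \<forall>x\<in>fst c \<inter> f -` fst d. \<forall>v.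
        \<tau> c (snd c x) v = \<omega> d (snd d (f x)) (coord_deriv c d f x v))"

definition is_pullback3 ::
    "('m, 'e::euclidean_space) chart set \<Rightarrow> ('n, 'f::euclidean_space) chart set \<Rightarrow> ('m \<Rightarrow> 'n) \<Rightarrow>
     ('n, 'f, 'v) form3 \<Rightarrow> ('m, 'e, 'v) form3 \<Rightarrow> bool" where
  "is_pullback3 A B f \<omega> \<tau> \<longleftrightarrow>
     (\<forall>c\<in>A. \<forall>d\<in>B. \<forall>x\<in>fst c \<inter> f -` fst d. \<forall>v1 v2 v3.
        \<tau> c (snd c x) v1 v2 v3 =
          \<omega> d (snd d (f x)) (coord_deriv c d f x v1) (coord_deriv c d f x v2) (coord_deriv c d f x v3))"

text \<open>The last conjunct is the transformation law under coordinate changes.\<close>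

definition one_form ::
    "('m, 'e::euclidean_space) chart set \<Rightarrow> ('m, 'e, 'v::real_normed_vector) form1 \<Rightarrow> bool" where
  "one_form A \<omega> \<longleftrightarrow>
     (\<forall>c\<in>A. (\<forall>y\<in>snd c ` fst c. linear (\<omega> c y)) \<and> (\<forall>v. C_infinity_on (snd c ` fst c) (\<lambda>y. \<omega> c y v))) \<and>
     is_pullback1 A A id \<omega> \<omega>"

definition ext_d1 :: "('m, 'e::euclidean_space, 'v::real_normed_vector) form1 \<Rightarrow> ('m, 'e, 'v) form2" where
  "ext_d1 \<alpha> = (\<lambda>c y v1 v2.
     frechet_derivative (\<lambda>y. \<alpha> c y v2) (at y) v1 - frechet_derivative (\<lambda>y. \<alpha> c y v1) (at y) v2)"

definition ext_d2 :: "('m, 'e::euclidean_space, 'v::real_normed_vector) form2 \<Rightarrow> ('m, 'e, 'v) form3" where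
  "ext_d2 \<beta> = (\<lambda>c y v1 v2 v3.
     frechet_derivative (\<lambda>y. \<beta> c y v2 v3) (at y) v1 - frechet_derivative (\<lambda>y. \<beta> c y v1 v3) (at y) v2
       + frechet_derivative (\<lambda>y. \<beta> c y v1 v2) (at y) v3)"

text \<open>The wedge product combined with a bilinear map \<open>b\<close> of the coefficients,
  \<open>(\<alpha> \<otimes> \<xi>, \<beta> \<otimes> \<eta>) \<mapsto> (\<alpha> \<and> \<beta>) \<otimes> b \<xi> \<eta>\<close>, for 1-forms with 1-forms and 1-forms with 2-forms.\<close>

definition wedge11 ::
    "('v \<Rightarrow> 'w \<Rightarrow> 'z::real_vector) \<Rightarrow> ('m, 'e, 'v) form1 \<Rightarrow> ('m, 'e, 'w) form1 \<Rightarrow> ('m, 'e, 'z) form2" where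
  "wedge11 b \<alpha> \<beta> = (\<lambda>c y v1 v2. b (\<alpha> c y v1) (\<beta> c y v2) - b (\<alpha> c y v2) (\<beta> c y v1))"

definition wedge12 ::
    "('v \<Rightarrow> 'w \<Rightarrow> 'z::real_vector) \<Rightarrow> ('m, 'e, 'v) form1 \<Rightarrow> ('m, 'e, 'w) form2 \<Rightarrow> ('m, 'e, 'z) form3" where
  "wedge12 b \<alpha> \<beta> = (\<lambda>c y v1 v2 v3.
     b (\<alpha> c y v1) (\<beta> c y v2 v3) - b (\<alpha> c y v2) (\<beta> c y v1 v3) + b (\<alpha> c y v3) (\<beta> c y v1 v2))"

section \<open>The group \<open>Nil \<rtimes> SO(2)\<close> and its Lie algebra\<close>

text \<open>\<open>Nil\<close> is taken in exponential coordinates: \<open>(x + \<i>y, z)\<close> corresponds to the unitriangular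
  matrix with entries \<open>x\<close>, \<open>y\<close> above the diagonal and \<open>z + xy/2\<close> in the corner. The term
  \<open>Im (cnj w * w') / 2\<close> is \<open>(xy' - yx') / 2\<close>.\<close>

fun nil_mult :: "complex \<times> real \<Rightarrow> complex \<times> real \<Rightarrow> complex \<times> real" where
  "nil_mult (w, z) (w', z') = (w + w', z + z' + Im (cnj w * w') / 2)"

text \<open>\<open>SO(2)\<close> is the group of unit complex numbers, acting on \<open>Nil\<close> by rotations about the
  \<open>z\<close>-axis; in these coordinates they are automorphisms.\<close>

fun so2_act :: "complex \<Rightarrow> complex \<times> real \<Rightarrow> complex \<times> real" where
  "so2_act u (w, z) = (u * w, z)"

type_synonym isonil = "(complex \<times> real) \<times> complex"

definition isom_nil :: "isonil monoid" where
  "isom_nil = \<lparr>carrier = UNIV \<times> {u. cmod u = 1},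
     mult = (\<lambda>(n, u) (n', u'). (nil_mult n (so2_act u n'), u * u')),
     one = ((0, 0), 1)\<rparr>"

lemma group_isom_nil: "group isom_nil"
proof (rule groupI)
  fix g assume "g \<in> carrier isom_nil"
  then obtain w z u where g: "g = ((w, z), u)" "cmod u = 1"
    by (auto simp: isom_nil_def)
  have u: "cnj u * u = 1"
    using g(2) by (metis complex_norm_square mult.commute of_real_1 one_power2)
  have "Im (cnj w * w) = 0"
    by simp
  then have "Im (cnj (cnj u * w) * (cnj u * w)) = 0"
    by (simp add: algebra_simps)
  then have "((- (cnj u * w), - z), cnj u) \<otimes>\<^bsub>isom_nil\<^esub> g = \<one>\<^bsub>isom_nil\<^esub>"
    using u by (simp add: isom_nil_def g(1) del: complex_cnj_mult)
  moreover have "((- (cnj u * w), - z), cnj u) \<in> carrier isom_nil"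
    using g(2) by (simp add: isom_nil_def)
  ultimately show "\<exists>h\<in>carrier isom_nil. h \<otimes>\<^bsub>isom_nil\<^esub> g = \<one>\<^bsub>isom_nil\<^esub>"
    by blast
next
  fix a b c assume "a \<in> carrier isom_nil" "b \<in> carrier isom_nil" "c \<in> carrier isom_nil"
  then obtain w1 z1 u1 w2 z2 u2 w3 z3 u3
    where abc: "a = ((w1, z1), u1)" "b = ((w2, z2), u2)" "c = ((w3, z3), u3)"
      and "cmod u1 = 1"
    by (auto simp: isom_nil_def)
  then have u1: "cnj u1 * u1 = 1"
    by (metis complex_norm_square mult.commute of_real_1 one_power2)
  have "cnj (u1 * w2) * (u1 * u2 * w3) = (cnj u1 * u1) * (cnj w2 * (u2 * w3))"
    by (simp add: mult_ac)
  then have "cnj (u1 * w2) * (u1 * u2 * w3) = cnj w2 * (u2 * w3)"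
    by (simp only: u1 mult_1_left)
  then have "Im (cnj w1 * (u1 * w2)) + Im (cnj (w1 + u1 * w2) * (u1 * u2 * w3)) =
      Im (cnj w2 * (u2 * w3)) + Im (cnj w1 * (u1 * (w2 + u2 * w3)))"
    by (simp only: complex_cnj_add distrib_right distrib_left plus_complex.sel mult.assoc)
  then show "a \<otimes>\<^bsub>isom_nil\<^esub> b \<otimes>\<^bsub>isom_nil\<^esub> c = a \<otimes>\<^bsub>isom_nil\<^esub> (b \<otimes>\<^bsub>isom_nil\<^esub> c)"
    by (simp add: isom_nil_def abc field_simps del: plus_complex.sel times_complex.sel complex_cnj_mult complex_cnj_add)
qed (auto simp: isom_nil_def norm_mult)

text \<open>Elements of the Lie algebra are written in the basis \<open>X, Y, Z, R\<close>. It is identified with the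
  tangent space at the identity through the parametrization \<open>isonil_param\<close>, whose local inverse is
  \<open>isonil_chart\<close>.\<close>

type_synonym lie = "real \<times> real \<times> real \<times> real"

definition lie_X :: lie where "lie_X = (1, 0, 0, 0)"
definition lie_Y :: lie where "lie_Y = (0, 1, 0, 0)"
definition lie_Z :: lie where "lie_Z = (0, 0, 1, 0)"
definition lie_R :: lie where "lie_R = (0, 0, 0, 1)"

fun lie_bracket :: "lie \<Rightarrow> lie \<Rightarrow> lie" where
  "lie_bracket (x, y, z, r) (x', y', z', r') = (y * r' - r * y', r * x' - x * r', x * y' - y * x', 0)"

lemma lie_bracket_basis:
  "lie_bracket lie_X lie_Y = lie_Z" "lie_bracket lie_R lie_X = lie_Y" "lie_bracket lie_R lie_Y = - lie_X"
  "lie_bracket lie_X lie_Z = 0" "lie_bracket lie_Y lie_Z = 0" "lie_bracket lie_R lie_Z = 0"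
  by (simp_all add: lie_X_def lie_Y_def lie_Z_def lie_R_def zero_prod_def)

fun inv_poly :: "real \<Rightarrow> real \<Rightarrow> lie \<Rightarrow> lie \<Rightarrow> real" where
  "inv_poly c1 c2 (x, y, z, r) (x', y', z', r') =
     c1 * (x * x' + y * y' + z * r' + r * z') + c2 * (r * r')"

fun isonil_param :: "lie \<Rightarrow> isonil" where
  "isonil_param (x, y, z, r) = ((Complex x y, z), cis r)"

definition isonil_chart :: "(isonil, lie) chart" where
  "isonil_chart = (UNIV \<times> {u. cmod u = 1 \<and> u \<noteq> - 1}, \<lambda>((w, z), u). (Re w, Im w, z, Arg u))"

text \<open>The left translates of the chart at the identity.\<close>

definition isonil_atlas :: "(isonil, lie) chart set" where
  "isonil_atlas =
     {((\<lambda>g. h \<otimes>\<^bsub>isom_nil\<^esub> g) ` fst isonil_chart, \<lambda>g. snd isonil_chart (inv\<^bsub>isom_nil\<^esub> h \<otimes>\<^bsub>isom_nil\<^esub> g)) |h.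
        h \<in> carrier isom_nil}"

text \<open>The adjoint representation: the differential at the identity of conjugation by \<open>g\<close>.\<close>

definition Ad :: "isonil \<Rightarrow> lie \<Rightarrow> lie" where
  "Ad g = frechet_derivative
     (\<lambda>\<eta>. snd isonil_chart (g \<otimes>\<^bsub>isom_nil\<^esub> isonil_param \<eta> \<otimes>\<^bsub>isom_nil\<^esub> inv\<^bsub>isom_nil\<^esub> g)) (at 0)"

section \<open>Fundamental group, universal cover and the flat bundle of a representation\<close>

definition path_class :: "(real \<Rightarrow> 'm::topological_space) \<Rightarrow> (real \<Rightarrow> 'm) set" where
  "path_class p = {q. homotopic_paths UNIV p q}"

definition class_mult ::
    "(real \<Rightarrow> 'm::topological_space) set \<Rightarrow> (real \<Rightarrow> 'm) set \<Rightarrow> (real \<Rightarrow> 'm) set" where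
  "class_mult a b = (\<Union>p\<in>a. \<Union>q\<in>b. path_class (p +++ q))"

definition fundamental_group :: "'m::topological_space \<Rightarrow> (real \<Rightarrow> 'm) set monoid" where
  "fundamental_group x0 =
     \<lparr>carrier = {path_class p |p. path p \<and> pathstart p = x0 \<and> pathfinish p = x0},
      mult = class_mult, one = path_class (\<lambda>_. x0)\<rparr>"

text \<open>Points of the universal cover are homotopy classes of paths from the base point; the
  fundamental group acts on it from the left by \<open>class_mult\<close>.\<close>

definition universal_cover :: "'m::topological_space \<Rightarrow> (real \<Rightarrow> 'm) set set" where
  "universal_cover x0 = {path_class p |p. path p \<and> pathstart p = x0}"

definition cover_proj :: "(real \<Rightarrow> 'm::topological_space) set \<Rightarrow> 'm" where
  "cover_proj a = pathfinish (SOME p. p \<in> a)"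

text \<open>The section over a simply connected open set \<open>U\<close> through the point \<open>a\<close> above \<open>U\<close>: prolong \<open>a\<close> by
  a path inside \<open>U\<close>. Its image is the sheet over \<open>U\<close> through \<open>a\<close>.\<close>

definition cover_section ::
    "'m::topological_space set \<Rightarrow> (real \<Rightarrow> 'm) set \<Rightarrow> 'm \<Rightarrow> (real \<Rightarrow> 'm) set" where
  "cover_section U a x =
     (\<Union>p\<in>a. \<Union>q\<in>{q. path q \<and> path_image q \<subseteq> U \<and> pathstart q = pathfinish p \<and> pathfinish q = x}.
        path_class (p +++ q))"

definition cover_atlas ::
    "('m::topological_space, 'e) chart set \<Rightarrow> 'm \<Rightarrow> ((real \<Rightarrow> 'm) set, 'e) chart set" where
  "cover_atlas A x0 =
     {(cover_section U a ` U, \<phi> \<circ> cover_proj) |U V \<phi> a.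
        (V, \<phi>) \<in> A \<and> U \<subseteq> V \<and> open U \<and> simply_connected U \<and>
        a \<in> universal_cover x0 \<and> cover_proj a \<in> U}"

type_synonym 'm flat_pt = "((real \<Rightarrow> 'm) set \<times> isonil) set"

text \<open>\<open>\<gamma>\<close> acts on the product of the universal cover with the group by \<open>\<gamma> (a, g) = (\<gamma> a, \<rho>(\<gamma>) g)\<close>.
  The bundle is the set of orbits; its points are sets of pairs.\<close>

definition flat_rel ::
    "'m::topological_space \<Rightarrow> ((real \<Rightarrow> 'm) set \<Rightarrow> isonil) \<Rightarrow>
     (((real \<Rightarrow> 'm) set \<times> isonil) \<times> ((real \<Rightarrow> 'm) set \<times> isonil)) set" where
  "flat_rel x0 \<rho> =
     {((a, g), (class_mult \<gamma> a, \<rho> \<gamma> \<otimes>\<^bsub>isom_nil\<^esub> g)) |\<gamma> a g.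
        \<gamma> \<in> carrier (fundamental_group x0) \<and> a \<in> universal_cover x0 \<and> g \<in> carrier isom_nil}"

definition flat_bundle ::
    "'m::topological_space \<Rightarrow> ((real \<Rightarrow> 'm) set \<Rightarrow> isonil) \<Rightarrow> 'm flat_pt set" where
  "flat_bundle x0 \<rho> = (universal_cover x0 \<times> carrier isom_nil) // flat_rel x0 \<rho>"

definition flat_proj :: "'m::topological_space flat_pt \<Rightarrow> 'm" where
  "flat_proj u = cover_proj (fst (SOME z. z \<in> u))"

definition flat_act :: "'m flat_pt \<Rightarrow> isonil \<Rightarrow> 'm flat_pt" where
  "flat_act u h = (\<lambda>(a, g). (a, g \<otimes>\<^bsub>isom_nil\<^esub> h)) ` u"

definition flat_atlas ::
    "('m::topological_space, 'e) chart set \<Rightarrow> 'm \<Rightarrow> ((real \<Rightarrow> 'm) set \<Rightarrow> isonil) \<Rightarrow>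
     ('m flat_pt, 'e \<times> lie) chart set" where
  "flat_atlas A x0 \<rho> =
     quotient_atlas (\<lambda>z. flat_rel x0 \<rho> `` {z}) (product_atlas (cover_atlas A x0) isonil_atlas)"

text \<open>Isomorphism with the product principal bundle.\<close>

definition flat_bundle_trivial ::
    "('m::topological_space, 'e::euclidean_space) chart set \<Rightarrow> 'm \<Rightarrow> ((real \<Rightarrow> 'm) set \<Rightarrow> isonil) \<Rightarrow> bool" where
  "flat_bundle_trivial A x0 \<rho> \<longleftrightarrow>
     (\<exists>\<Phi> :: 'm \<times> isonil \<Rightarrow> 'm flat_pt.
        bij_betw \<Phi> (UNIV \<times> carrier isom_nil) (flat_bundle x0 \<rho>) \<and>
        smooth_map (product_atlas A isonil_atlas) (flat_atlas A x0 \<rho>) \<Phi> \<and>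
        smooth_map (flat_atlas A x0 \<rho>) (product_atlas A isonil_atlas)
          (the_inv_into (UNIV \<times> carrier isom_nil) \<Phi>) \<and>
        (\<forall>x. \<forall>g\<in>carrier isom_nil. flat_proj (\<Phi> (x, g)) = x \<and>
           (\<forall>h\<in>carrier isom_nil. \<Phi> (x, g \<otimes>\<^bsub>isom_nil\<^esub> h) = flat_act (\<Phi> (x, g)) h)))"

definition smooth_section ::
    "('m::topological_space, 'e::euclidean_space) chart set \<Rightarrow> 'm \<Rightarrow> ((real \<Rightarrow> 'm) set \<Rightarrow> isonil) \<Rightarrow>
     ('m \<Rightarrow> 'm flat_pt) \<Rightarrow> bool" where
  "smooth_section A x0 \<rho> s \<longleftrightarrow>
     (\<forall>x. s x \<in> flat_bundle x0 \<rho> \<and> flat_proj (s x) = x) \<and> smooth_map A (flat_atlas A x0 \<rho>) s"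

section \<open>Connections and Chern--Simons forms\<close>

text \<open>In what follows \<open>B\<close> is the atlas of the total space and \<open>act\<close> the right action of the group.\<close>

text \<open>The fundamental vector field of \<open>\<xi>\<close> at \<open>u\<close>, in the chart \<open>d\<close>: the differential at the identity
  of the orbit map \<open>g \<mapsto> u g\<close>, applied to \<open>\<xi>\<close>.\<close>

definition fundamental_vector ::
    "('p \<Rightarrow> isonil \<Rightarrow> 'p) \<Rightarrow> ('p, 'f::euclidean_space) chart \<Rightarrow> 'p \<Rightarrow> lie \<Rightarrow> 'f" where
  "fundamental_vector act d u = frechet_derivative (\<lambda>\<eta>. snd d (act u (isonil_param \<eta>))) (at 0)"

definition principal_connection ::
    "('p, 'f::euclidean_space) chart set \<Rightarrow> ('p \<Rightarrow> isonil \<Rightarrow> 'p) \<Rightarrow> ('p, 'f, lie) form1 \<Rightarrow> bool" where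
  "principal_connection B act \<omega> \<longleftrightarrow>
     one_form B \<omega> \<and>
     (\<forall>g\<in>carrier isom_nil.
        is_pullback1 B B (\<lambda>u. act u g) \<omega> (\<lambda>d y v. Ad (inv\<^bsub>isom_nil\<^esub> g) (\<omega> d y v))) \<and>
     (\<forall>d\<in>B. \<forall>u\<in>fst d. \<forall>\<xi>. \<omega> d (snd d u) (fundamental_vector act d u \<xi>) = \<xi>)"

definition curvature :: "('p, 'f::euclidean_space, lie) form1 \<Rightarrow> ('p, 'f, lie) form2" where
  "curvature \<omega> = (\<lambda>d y v1 v2. ext_d1 \<omega> d y v1 v2 + (1 / 2) *\<^sub>R wedge11 lie_bracket \<omega> \<omega> d y v1 v2)"

definition flat_connection ::
    "('p, 'f::euclidean_space) chart set \<Rightarrow> ('p \<Rightarrow> isonil \<Rightarrow> 'p) \<Rightarrow> ('p, 'f, lie) form1 \<Rightarrow> bool" where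
  "flat_connection B act \<omega> \<longleftrightarrow>
     principal_connection B act \<omega> \<and> (\<forall>d\<in>B. \<forall>u\<in>fst d. \<forall>v1 v2. curvature \<omega> d (snd d u) v1 v2 = 0)"

definition is_trivial_connection ::
    "('m, 'e::euclidean_space) chart set \<Rightarrow> ('p, 'f::euclidean_space) chart set \<Rightarrow> ('p \<Rightarrow> isonil \<Rightarrow> 'p) \<Rightarrow>
     ('m \<Rightarrow> 'p) \<Rightarrow> ('p, 'f, lie) form1 \<Rightarrow> bool" where
  "is_trivial_connection A B act s \<omega> \<longleftrightarrow>
     flat_connection B act \<omega> \<and> is_pullback1 A B s \<omega> (\<lambda>c y v. 0)"

definition form1_diff :: "('p, 'f, 'v::real_vector) form1 \<Rightarrow> ('p, 'f, 'v) form1 \<Rightarrow> ('p, 'f, 'v) form1" where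
  "form1_diff \<omega>1 \<omega>0 = (\<lambda>d y v. \<omega>1 d y v - \<omega>0 d y v)"

definition cov_d :: "('p, 'f::euclidean_space, lie) form1 \<Rightarrow> ('p, 'f, lie) form1 \<Rightarrow> ('p, 'f, lie) form2" where
  "cov_d \<omega>0 a = (\<lambda>d y v1 v2. ext_d1 a d y v1 v2 + wedge11 lie_bracket \<omega>0 a d y v1 v2)"

text \<open>Forms on the base with values in the adjoint bundle are regarded, as usual, as horizontal
  equivariant forms on the total space, and real forms on the base as basic forms on the total
  space (via the injective pullback along the projection). \<open>CS_upstairs b \<omega>1 \<omega>0\<close> is the relative
  Chern--Simons form as a form on the total space, and \<open>is_CS_form A B \<pi> b \<omega>1 \<omega>0 \<eta>\<close> says that the
  form on the base to which it descends is \<open>\<eta>\<close>.\<close>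

definition CS_upstairs ::
    "(lie \<Rightarrow> lie \<Rightarrow> real) \<Rightarrow> ('p, 'f::euclidean_space, lie) form1 \<Rightarrow> ('p, 'f, lie) form1 \<Rightarrow>
     ('p, 'f, real) form3" where
  "CS_upstairs b \<omega>1 \<omega>0 = (let a = form1_diff \<omega>1 \<omega>0 in
     (\<lambda>d y v1 v2 v3.
        wedge12 b a (cov_d \<omega>0 a) d y v1 v2 v3
        + (1 / 3) * wedge12 b a (wedge11 lie_bracket a a) d y v1 v2 v3
        + 2 * wedge12 b a (curvature \<omega>0) d y v1 v2 v3))"

definition is_CS_form ::
    "('m, 'e::euclidean_space) chart set \<Rightarrow> ('p, 'f::euclidean_space) chart set \<Rightarrow> ('p \<Rightarrow> 'm) \<Rightarrow>
     (lie \<Rightarrow> lie \<Rightarrow> real) \<Rightarrow> ('p, 'f, lie) form1 \<Rightarrow> ('p, 'f, lie) form1 \<Rightarrow> ('m, 'e, real) form3 \<Rightarrow> bool" where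
  "is_CS_form A B \<pi> b \<omega>1 \<omega>0 \<eta> \<longleftrightarrow> is_pullback3 B A \<pi> \<eta> (CS_upstairs b \<omega>1 \<omega>0)"

end

theory Submission
  imports Defs
begin

text \<open>Write \<open>a\<close> for the difference of the two connections. Subtracting their flatness equations gives
  \<open>d\<^bsub>\<omega>0\<^esub> a = - [a, a] / 2\<close>, so that the Chern--Simons form at a point is \<open>- \<langle>a\<^sub>1, [a\<^sub>2, a\<^sub>3]\<rangle>\<close>, where
  \<open>a\<^sub>i\<close> are the values of \<open>a\<close> on three tangent vectors. Since \<open>a\<close> vanishes on vertical vectors and is
  equivariant, at the point \<open>s(x) k\<close> it is \<open>Ad(k\<^sup>-\<^sup>1)\<close> of \<open>\<alpha> = s\<^sup>* a\<close>, and \<open>k\<close> drops out by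
  invariance of the triple product, which is \<open>c\<^sub>1\<close> times the determinant of the \<open>X, Y, R\<close> components.
  As \<open>s\<close> pulls the trivial connection back to \<open>0\<close>, the form \<open>\<alpha>\<close> is itself flat:
  \<open>d \<alpha>\<^sub>Z = - \<alpha>\<^sub>X \<and> \<alpha>\<^sub>Y\<close> and \<open>d \<alpha>\<^sub>R = 0\<close>, whence \<open>d (\<alpha>\<^sub>Z \<and> \<alpha>\<^sub>R) = - \<alpha>\<^sub>X \<and> \<alpha>\<^sub>Y \<and> \<alpha>\<^sub>R\<close>.\<close>

section \<open>Symmetry of second derivatives and pullback of forms\<close>

lemma C_infinity_on_differentiable:
  assumes "C_infinity_on S f" "x \<in> S"
  shows "f differentiable (at x)"
  using assms C_on.simps(2)[of 0 S f] unfolding C_infinity_on_def by blast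

lemma C_infinity_on_frechet:
  assumes "C_infinity_on S f"
  shows "C_infinity_on S (\<lambda>x. frechet_derivative f (at x) v)"
  using assms C_on.simps(2)[of _ S f] unfolding C_infinity_on_def by blast

lemma C_infinity_on_continuous:
  assumes "C_infinity_on S f"
  shows "continuous_on S f"
  using assms C_on.simps(1)[of S f] unfolding C_infinity_on_def by blast

lemma C_infinity_on_has_derivative:
  assumes "C_infinity_on S f" "x \<in> S"
  shows "(f has_derivative frechet_derivative f (at x)) (at x)"
  using C_infinity_on_differentiable[OF assms] frechet_derivative_works by blast

text \<open>The mean value theorem, applied in the direction \<open>v\<close> to the increment in the direction \<open>w\<close>
  and then in the direction \<open>w\<close>, finds a mixed derivative equal to the second difference quotient.\<close>

lemma second_difference_mvt:
  fixes f :: "'a::euclidean_space \<Rightarrow> real"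
  assumes f: "C_infinity_on S f" and h: "0 < h"
    and box: "\<And>s t. 0 \<le> s \<Longrightarrow> s \<le> h \<Longrightarrow> 0 \<le> t \<Longrightarrow> t \<le> h \<Longrightarrow> x + s *\<^sub>R v + t *\<^sub>R w \<in> S"
  obtains s t where "0 < s" "s < h" "0 < t" "t < h"
    "f (x + h *\<^sub>R v + h *\<^sub>R w) - f (x + h *\<^sub>R v) - f (x + h *\<^sub>R w) + f x =
      h * h * frechet_derivative (\<lambda>y. frechet_derivative f (at y) v) (at (x + s *\<^sub>R v + t *\<^sub>R w)) w"
proof -
  have lin: "frechet_derivative g (at y) (c *\<^sub>R u) = c *\<^sub>R frechet_derivative g (at y) u"
    if "C_infinity_on S g" "y \<in> S" for g :: "'a \<Rightarrow> real" and y c u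
    using linear_frechet_derivative[OF C_infinity_on_differentiable[OF that]] linear_cmul by blast
  have D: "((\<lambda>s. g (y + s *\<^sub>R u)) has_real_derivative frechet_derivative g (at (y + s *\<^sub>R u)) u) (at s)"
    if "C_infinity_on S g" "y + s *\<^sub>R u \<in> S" for g :: "'a \<Rightarrow> real" and y u s
  proof -
    have "((\<lambda>s. g (y + s *\<^sub>R u)) has_derivative (\<lambda>d. frechet_derivative g (at (y + s *\<^sub>R u)) (d *\<^sub>R u))) (at s)"
      by (rule has_derivative_compose[where f = "\<lambda>s. y + s *\<^sub>R u", OF _ C_infinity_on_has_derivative[OF that]])
         (auto intro!: derivative_eq_intros)
    then show ?thesis
      by (simp add: has_field_derivative_def lin[OF that] mult_commute_abs)
  qed
  let ?F = "\<lambda>s. f ((x + h *\<^sub>R w) + s *\<^sub>R v) - f (x + s *\<^sub>R v)"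
  let ?F' = "\<lambda>s. frechet_derivative f (at ((x + h *\<^sub>R w) + s *\<^sub>R v)) v - frechet_derivative f (at (x + s *\<^sub>R v)) v"
  have "(?F has_real_derivative ?F' s) (at s)" if "0 \<le> s" "s \<le> h" for s
    by (rule DERIV_diff; rule D[OF f]) (use box[of s h] box[of s 0] that h in \<open>auto simp: add_ac\<close>)
  from MVT2[OF h, of ?F ?F'] this
  obtain s where s: "0 < s" "s < h" "?F h - ?F 0 = h * ?F' s"
    by auto
  let ?G = "\<lambda>t. frechet_derivative f (at ((x + s *\<^sub>R v) + t *\<^sub>R w)) v"
  let ?G' = "\<lambda>t. frechet_derivative (\<lambda>y. frechet_derivative f (at y) v) (at ((x + s *\<^sub>R v) + t *\<^sub>R w)) w"
  have "(?G has_real_derivative ?G' t) (at t)" if "0 \<le> t" "t \<le> h" for t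
    by (rule D[OF C_infinity_on_frechet[OF f]]) (use box[of s t] that s in auto)
  from MVT2[OF h, of ?G ?G'] this
  obtain t where t: "0 < t" "t < h" "?G h - ?G 0 = h * ?G' t"
    by auto
  have "?F' s = h * ?G' t"
    using t(3) by (simp add: add_ac)
  with s(3) have "f (x + h *\<^sub>R v + h *\<^sub>R w) - f (x + h *\<^sub>R v) - f (x + h *\<^sub>R w) + f x = h * h * ?G' t"
    by (simp add: add_ac)
  with s t that show ?thesis by blast
qed

text \<open>The second difference is symmetric in \<open>v\<close> and \<open>w\<close>, so the two
  mixed derivatives, each taken at a suitable point arbitrarily close to \<open>x\<close>, are
  equal; continuity brings the equality to \<open>x\<close>.\<close>

lemma real_mixed_derivatives_commute:
  fixes f :: "'a::euclidean_space \<Rightarrow> real"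
  assumes f: "C_infinity_on S f" and S: "open S" "x \<in> S"
  shows "frechet_derivative (\<lambda>y. frechet_derivative f (at y) v) (at x) w =
    frechet_derivative (\<lambda>y. frechet_derivative f (at y) w) (at x) v"
proof -
  define P where "P v w y = frechet_derivative (\<lambda>y. frechet_derivative f (at y) v) (at y) w" for v w y
  have cont: "isCont (P v w) x" for v w
    unfolding P_def
    using C_infinity_on_continuous[OF C_infinity_on_frechet[OF C_infinity_on_frechet[OF f]]] S
      continuous_on_eq_continuous_at by blast
  obtain e where e: "e > 0" "ball x e \<subseteq> S"
    using S open_contains_ball by blast
  \<comment> \<open>\<open>h * K\<close> bounds the distance to \<open>x\<close> on the
    parallelogram spanned by \<open>h *\<^sub>R v\<close> and \<open>h *\<^sub>R w\<close>; the
    summand 1 keeps \<open>K\<close> positive when both vectors vanish.\<close>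
  define K where "K = norm v + norm w + 1"
  have K: "K > 0" unfolding K_def by (smt (verit) norm_ge_zero)
  have near: "dist (x + s *\<^sub>R v + t *\<^sub>R w) x \<le> h * K"
    if "0 \<le> s" "s \<le> h" "0 \<le> t" "t \<le> h" for s t h :: real
  proof -
    have "dist (x + s *\<^sub>R v + t *\<^sub>R w) x = norm (s *\<^sub>R v + t *\<^sub>R w)"
      by (simp add: dist_norm)
    also have "\<dots> \<le> s * norm v + t * norm w"
      using norm_triangle_ineq[of "s *\<^sub>R v" "t *\<^sub>R w"] that by simp
    also have "\<dots> \<le> h * norm v + h * norm w"
      using that by (intro add_mono mult_right_mono) auto
    also have "\<dots> \<le> h * K"
      unfolding K_def using that by (simp add: distrib_left)
    finally show ?thesis .
  qed
  have "\<bar>P v w x - P w v x\<bar> < r" if r: "r > 0" for r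
  proof -
    have "\<exists>d>0. \<forall>y. dist y x < d \<longrightarrow> dist (P v w y) (P v w x) < r / 2" for v w
      using cont[of v w] r unfolding continuous_at_eps_delta by (meson half_gt_zero)
    then obtain d1 d2 where d: "d1 > 0" "d2 > 0"
      "\<And>y. dist y x < d1 \<Longrightarrow> dist (P v w y) (P v w x) < r / 2"
      "\<And>y. dist y x < d2 \<Longrightarrow> dist (P w v y) (P w v x) < r / 2"
      by metis
    \<comment> \<open>The factor 2 keeps the parallelogram strictly inside three balls: the one
      contained in \<open>S\<close> and the two given by continuity.\<close>
    define h where "h = min e (min d1 d2) / (2 * K)"
    have h: "h > 0" unfolding h_def using e d K by simp
    have "h * K = min e (min d1 d2) / 2"
      unfolding h_def using K by simp
    then have hK: "h * K < e" "h * K < d1" "h * K < d2"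
      using e d by auto
    have box: "x + s *\<^sub>R v + t *\<^sub>R w \<in> S"
      if "0 \<le> s" "s \<le> h" "0 \<le> t" "t \<le> h" for s t
      using near[OF that] hK(1) e(2) by (auto simp: mem_ball dist_commute subset_iff)
    obtain s t where st: "0 < s" "s < h" "0 < t" "t < h"
      "f (x + h *\<^sub>R v + h *\<^sub>R w) - f (x + h *\<^sub>R v) - f (x + h *\<^sub>R w) + f x =
        h * h * P v w (x + s *\<^sub>R v + t *\<^sub>R w)"
      unfolding P_def by (rule second_difference_mvt[OF f h box])
    have box': "x + s *\<^sub>R w + t *\<^sub>R v \<in> S"
      if "0 \<le> s" "s \<le> h" "0 \<le> t" "t \<le> h" for s t
      using box[of t s] that by (simp add: add_ac)
    obtain s' t' where st': "0 < s'" "s' < h" "0 < t'" "t' < h"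
      "f (x + h *\<^sub>R w + h *\<^sub>R v) - f (x + h *\<^sub>R w) - f (x + h *\<^sub>R v) + f x =
        h * h * P w v (x + s' *\<^sub>R w + t' *\<^sub>R v)"
      unfolding P_def by (rule second_difference_mvt[OF f h box'])
    \<comment> \<open>Multiplied by \<open>h * h\<close>, both sides are the same second difference,
      with the two directions taken in either order.\<close>
    have "P v w (x + s *\<^sub>R v + t *\<^sub>R w) = P w v (x + t' *\<^sub>R v + s' *\<^sub>R w)"
    proof -
      have "h * h * P v w (x + s *\<^sub>R v + t *\<^sub>R w) = h * h * P w v (x + s' *\<^sub>R w + t' *\<^sub>R v)"
        unfolding st(5)[symmetric] st'(5)[symmetric] by (simp add: add_ac)
      then show ?thesis using h by (simp add: add_ac)
    qed
    moreover have "dist (P v w (x + s *\<^sub>R v + t *\<^sub>R w)) (P v w x) < r / 2"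
      using near[of s h t] st hK by (intro d(3)) simp
    moreover have "dist (P w v (x + t' *\<^sub>R v + s' *\<^sub>R w)) (P w v x) < r / 2"
      using near[of t' h s'] st' hK by (intro d(4)) simp
    ultimately show ?thesis
      unfolding dist_real_def by linarith
  qed
  \<comment> \<open>Taking \<open>r\<close> to be the difference itself would give
    \<open>r < r\<close>.\<close>
  then have "\<not> \<bar>P v w x - P w v x\<bar> > 0" by (metis less_irrefl)
  then show ?thesis unfolding P_def by simp
qed

lemma frechet_derivative_inner:
  assumes "f differentiable (at x)"
  shows "frechet_derivative (\<lambda>y. f y \<bullet> b) (at x) v = frechet_derivative f (at x) v \<bullet> b"
proof -
  have "((\<lambda>y. f y \<bullet> b) has_derivative (\<lambda>v. frechet_derivative f (at x) v \<bullet> b)) (at x)"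
    using assms frechet_derivative_works by (auto intro!: derivative_eq_intros)
  then show ?thesis using frechet_derivative_at by metis
qed

text \<open>Derivatives at a point depend only on values nearby, so on an open set agreement passes
  to the derivatives, and by induction to all orders.\<close>

lemma C_on_cong:
  assumes "open S" "\<And>x. x \<in> S \<Longrightarrow> f x = g x" "C_on k S f"
  shows "C_on k S g"
  using assms(2,3)
proof (induction k arbitrary: f g)
  case 0
  then show ?case by (simp cong: continuous_on_cong)
next
  case (Suc k)
  have "(g has_derivative frechet_derivative f (at x)) (at x)" if "x \<in> S" for x
  proof -
    have "(f has_derivative frechet_derivative f (at x)) (at x)"
      using Suc.prems(2) that frechet_derivative_works by auto
    then show ?thesis
      using has_derivative_transform_within_open[OF _ assms(1) that] Suc.prems(1) by blast
  qed
  moreover from this have "frechet_derivative f (at x) = frechet_derivative g (at x)" if "x \<in> S" for x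
    using frechet_derivative_at that by blast
  ultimately show ?case
    using Suc.IH[of "\<lambda>x. frechet_derivative f (at x) v" "\<lambda>x. frechet_derivative g (at x) v" for v] Suc.prems
    by (auto simp: differentiable_def)
qed

lemma C_infinity_on_inner:
  assumes "open S" "C_infinity_on S f"
  shows "C_infinity_on S (\<lambda>x. f x \<bullet> b)"
proof -
  have "C_on k S (\<lambda>x. f x \<bullet> b)" if "C_on k S f" for k
    using that
  proof (induction k arbitrary: f)
    case 0
    then show ?case by (auto intro!: continuous_intros)
  next
    case (Suc k)
    then have d: "f differentiable (at x)" if "x \<in> S" for x using that by auto
    have "C_on k S (\<lambda>x. frechet_derivative f (at x) v \<bullet> b)" for v
      using Suc by simp
    then have "C_on k S (\<lambda>x. frechet_derivative (\<lambda>y. f y \<bullet> b) (at x) v)" for v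
      by (rule C_on_cong[OF assms(1), rotated]) (simp add: frechet_derivative_inner d)
    moreover have "(\<lambda>y. f y \<bullet> b) differentiable (at x)" if "x \<in> S" for x
      using d[OF that] by simp
    ultimately show ?case by simp
  qed
  then show ?thesis using assms(2) unfolding C_infinity_on_def by blast
qed

text \<open>Inner products with basis vectors commute with both differentiations, which reduces the
  claim to real functions.\<close>

lemma mixed_derivatives_commute:
  fixes f :: "'a::euclidean_space \<Rightarrow> 'b::euclidean_space"
  assumes f: "C_infinity_on S f" and S: "open S" "x \<in> S"
  shows "frechet_derivative (\<lambda>y. frechet_derivative f (at y) v) (at x) w =
    frechet_derivative (\<lambda>y. frechet_derivative f (at y) w) (at x) v"
proof (rule euclidean_eqI)
  fix b :: 'b
  have D: "frechet_derivative (\<lambda>y. frechet_derivative f (at y) v) (at x) w \<bullet> b =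
    frechet_derivative (\<lambda>y. frechet_derivative (\<lambda>y. f y \<bullet> b) (at y) v) (at x) w" for v w
  proof -
    have d: "(\<lambda>y. frechet_derivative f (at y) v) differentiable (at x)"
      by (rule C_infinity_on_differentiable[OF C_infinity_on_frechet[OF f] S(2)])
    have "frechet_derivative (\<lambda>y. frechet_derivative f (at y) v) (at x) w \<bullet> b =
      frechet_derivative (\<lambda>y. frechet_derivative f (at y) v \<bullet> b) (at x) w"
      by (rule frechet_derivative_inner[OF d, symmetric])
    \<comment> \<open>The first derivatives are known to agree only on \<open>S\<close>; openness of
      \<open>S\<close> suffices for the outer derivative at \<open>x\<close>.\<close>
    also have "\<dots> = frechet_derivative (\<lambda>y. frechet_derivative (\<lambda>y. f y \<bullet> b) (at y) v) (at x) w"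
      by (rule arg_cong[where f = "\<lambda>F. F w"], rule frechet_derivative_transform_within_open[OF _ S])
         (use d in \<open>auto simp: frechet_derivative_inner C_infinity_on_differentiable[OF f]\<close>)
    finally show ?thesis .
  qed
  show "frechet_derivative (\<lambda>y. frechet_derivative f (at y) v) (at x) w \<bullet> b =
    frechet_derivative (\<lambda>y. frechet_derivative f (at y) w) (at x) v \<bullet> b"
    unfolding D by (rule real_mixed_derivatives_commute[OF C_infinity_on_inner[OF S(1) f] S])
qed

section \<open>Naturality of the exterior derivative of 1-forms\<close>

lemma linear_basis_expansion:
  fixes f :: "'a::euclidean_space \<Rightarrow> 'b::real_vector"
  assumes "linear f"
  shows "f w = (\<Sum>b\<in>Basis. (w \<bullet> b) *\<^sub>R f b)"
proof -
  have "f w = f (\<Sum>b\<in>Basis. (w \<bullet> b) *\<^sub>R b)"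
    by (simp add: euclidean_representation)
  also have "\<dots> = (\<Sum>b\<in>Basis. (w \<bullet> b) *\<^sub>R f b)"
    using assms by (simp add: linear_sum linear_cmul)
  finally show ?thesis .
qed

text \<open>Differentiability of the form is given for fixed vectors only. Expanding the moving
  vector in a basis turns the expression into a finite sum of products: one term differentiates the
  vector, the other the coefficients along \<open>F\<close>.\<close>

lemma has_derivative_pullback:
  fixes F :: "'a::euclidean_space \<Rightarrow> 'b::euclidean_space" and \<omega> :: "'b \<Rightarrow> 'b \<Rightarrow> 'v::real_normed_vector"
  assumes F: "C_infinity_on S F" and S: "open S" "y \<in> S"
    and T: "open T" "\<And>y. y \<in> S \<Longrightarrow> F y \<in> T"
    and lin: "\<And>z. z \<in> T \<Longrightarrow> linear (\<omega> z)"
    and diff: "\<And>b. (\<lambda>z. \<omega> z b) differentiable (at (F y))"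
  shows "((\<lambda>y. \<omega> (F y) (frechet_derivative F (at y) v)) has_derivative
    (\<lambda>u. \<omega> (F y) (frechet_derivative (\<lambda>y. frechet_derivative F (at y) v) (at y) u)
       + frechet_derivative (\<lambda>z. \<omega> z (frechet_derivative F (at y) v)) (at (F y))
           (frechet_derivative F (at y) u))) (at y)"
proof -
  let ?G = "\<lambda>y. frechet_derivative F (at y) v"
  let ?W = "\<lambda>b. frechet_derivative (\<lambda>z. \<omega> z b) (at (F y))"
  have DF: "(F has_derivative frechet_derivative F (at y)) (at y)"
    by (rule C_infinity_on_has_derivative[OF F S(2)])
  have DG: "(?G has_derivative frechet_derivative ?G (at y)) (at y)"
    by (rule C_infinity_on_has_derivative[OF C_infinity_on_frechet[OF F] S(2)])
  have W: "((\<lambda>z. \<omega> z b) has_derivative ?W b) (at (F y))" for b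
    using diff frechet_derivative_works by blast
  \<comment> \<open>Linearity in the vector argument holds throughout the open set \<open>T\<close>,
    hence passes to derivatives in the base point.\<close>
  have W': "?W w = (\<lambda>u. \<Sum>b\<in>Basis. (w \<bullet> b) *\<^sub>R ?W b u)" for w
  proof -
    have "((\<lambda>z. \<Sum>b\<in>Basis. (w \<bullet> b) *\<^sub>R \<omega> z b) has_derivative (\<lambda>u. \<Sum>b\<in>Basis. (w \<bullet> b) *\<^sub>R ?W b u)) (at (F y))"
      by (intro has_derivative_sum has_derivative_scaleR_right W)
    then have "((\<lambda>z. \<omega> z w) has_derivative (\<lambda>u. \<Sum>b\<in>Basis. (w \<bullet> b) *\<^sub>R ?W b u)) (at (F y))"
      by (rule has_derivative_transform_within_open[OF _ T(1) T(2)[OF S(2)]])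
         (simp add: linear_basis_expansion[OF lin, of _ w, symmetric])
    then show ?thesis using W has_derivative_unique by blast
  qed
  have WF: "((\<lambda>y. \<omega> (F y) b) has_derivative (\<lambda>u. ?W b (frechet_derivative F (at y) u))) (at y)" for b
    by (rule has_derivative_compose[OF DF W])
  have "((\<lambda>y. \<Sum>b\<in>Basis. (?G y \<bullet> b) *\<^sub>R \<omega> (F y) b) has_derivative
     (\<lambda>u. \<Sum>b\<in>Basis. (?G y \<bullet> b) *\<^sub>R ?W b (frechet_derivative F (at y) u)
        + (frechet_derivative ?G (at y) u \<bullet> b) *\<^sub>R \<omega> (F y) b)) (at y)"
    by (intro has_derivative_sum has_derivative_scaleR has_derivative_inner_left DG WF)
  then have "((\<lambda>y. \<omega> (F y) (?G y)) has_derivative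
     (\<lambda>u. \<Sum>b\<in>Basis. (?G y \<bullet> b) *\<^sub>R ?W b (frechet_derivative F (at y) u)
        + (frechet_derivative ?G (at y) u \<bullet> b) *\<^sub>R \<omega> (F y) b)) (at y)"
    by (rule has_derivative_transform_within_open[OF _ S])
       (simp add: linear_basis_expansion[OF lin[OF T(2)], symmetric])
  moreover have "(\<Sum>b\<in>Basis. (?G y \<bullet> b) *\<^sub>R ?W b (frechet_derivative F (at y) u)
        + (frechet_derivative ?G (at y) u \<bullet> b) *\<^sub>R \<omega> (F y) b) =
      \<omega> (F y) (frechet_derivative ?G (at y) u) + ?W (?G y) (frechet_derivative F (at y) u)" for u
    by (simp add: sum.distrib W'[of "?G y"] linear_basis_expansion[OF lin[OF T(2)[OF S(2)]], symmetric] add.commute)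
  ultimately show ?thesis by simp
qed

text \<open>The second derivatives of \<open>F\<close> cancel in the antisymmetrisation because they
  are symmetric; the remaining terms are the pullback of the exterior derivative.\<close>

lemma
  fixes F :: "'a::euclidean_space \<Rightarrow> 'b::euclidean_space" and \<omega> :: "('p, 'b, 'v::real_normed_vector) form1"
    and \<alpha> :: "('m, 'a, 'v) form1"
  assumes F: "C_infinity_on S F" and S: "open S" "y \<in> S"
    and T: "open T" "\<And>y. y \<in> S \<Longrightarrow> F y \<in> T"
    and lin: "\<And>z. z \<in> T \<Longrightarrow> linear (\<omega> d z)"
    and diff: "\<And>b. (\<lambda>z. \<omega> d z b) differentiable (at (F y))"
    and \<alpha>: "\<And>y v. y \<in> S \<Longrightarrow> \<alpha> c y v = \<omega> d (F y) (frechet_derivative F (at y) v)"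
  shows differentiable_pullback: "(\<lambda>y. \<alpha> c y v) differentiable (at y)"
    and ext_d1_pullback: "ext_d1 \<alpha> c y v w =
      ext_d1 \<omega> d (F y) (frechet_derivative F (at y) v) (frechet_derivative F (at y) w)"
proof -
  let ?D = "\<lambda>v u. \<omega> d (F y) (frechet_derivative (\<lambda>y. frechet_derivative F (at y) v) (at y) u)
       + frechet_derivative (\<lambda>z. \<omega> d z (frechet_derivative F (at y) v)) (at (F y))
           (frechet_derivative F (at y) u)"
  have D: "((\<lambda>y. \<alpha> c y v) has_derivative ?D v) (at y)" for v
    by (rule has_derivative_transform_within_open[OF
          has_derivative_pullback[of S F y T "\<omega> d" v, OF F S T lin diff] S])
       (simp_all add: \<alpha>)
  show "(\<lambda>y. \<alpha> c y v) differentiable (at y)"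
    by (rule differentiableI[OF D])
  have "frechet_derivative (\<lambda>y. \<alpha> c y v) (at y) = ?D v" for v
    using frechet_derivative_at[OF D] by (rule sym)
  then show "ext_d1 \<alpha> c y v w =
      ext_d1 \<omega> d (F y) (frechet_derivative F (at y) v) (frechet_derivative F (at y) w)"
    unfolding ext_d1_def by (simp add: mixed_derivatives_commute[OF F S, of v w])
qed

section \<open>The isometry group in exponential coordinates\<close>

text \<open>A bracket has zero R component, so the pairing reduces to \<open>c1\<close> times the
  determinant of the X, Y, R components.\<close>

lemma inv_poly_bracket:
  "inv_poly c1 c2 (x, y, z, r) (lie_bracket (x', y', z', r') (x'', y'', z'', r'')) =
    c1 * (x * (y' * r'' - r' * y'') + y * (r' * x'' - x' * r'') + r * (x' * y'' - y' * x''))"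
  by simp

text \<open>Conjugation by \<open>g\<close> and left multiplication by \<open>isonil_param \<eta>\<close>, in exponential coordinates.
  The pair \<open>(X, Y)\<close> is \<open>u\<close> times the complex number \<open>x + \<i>y\<close>, and \<open>(P, Q)\<close> is \<open>cis r\<close> times \<open>w\<close>.\<close>

definition conj_coord :: "isonil \<Rightarrow> lie \<Rightarrow> lie" where
  "conj_coord g = (\<lambda>(x, y, z, r). case g of ((w, t), u) \<Rightarrow>
     let X = Re u * x - Im u * y; Y = Re u * y + Im u * x;
       P = cos r * Re w - sin r * Im w; Q = cos r * Im w + sin r * Re w
     in (Re w + X - P, Im w + Y - Q,
         z + (Re w * Y - Im w * X) / 2 - ((Re w + X) * Q - (Im w + Y) * P) / 2, r))"

definition mult_coord :: "lie \<Rightarrow> lie \<Rightarrow> lie" where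
  "mult_coord = (\<lambda>(x, y, z, r) (x', y', z', r').
     let X = cos r * x' - sin r * y'; Y = cos r * y' + sin r * x'
     in (x + X, y + Y, z + z' + (x * Y - y * X) / 2, r + r'))"

lemma isonil_inv:
  assumes "cmod u = 1"
  shows "inv\<^bsub>isom_nil\<^esub> ((w, t), u) = ((- (cnj u * w), - t), cnj u)"
proof -
  interpret group isom_nil by (rule group_isom_nil)
  have u: "cnj u * u = 1"
    using assms by (metis complex_norm_square mult.commute of_real_1 one_power2)
  \<comment> \<open>A number times its conjugate is real, so the central term in the product with
    the inverse vanishes.\<close>
  have "Im (cnj (cnj u * w) * (cnj u * w)) = 0"
    by (simp add: algebra_simps)
  then have "((- (cnj u * w), - t), cnj u) \<otimes>\<^bsub>isom_nil\<^esub> ((w, t), u) = \<one>\<^bsub>isom_nil\<^esub>"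
    using u by (simp add: isom_nil_def del: complex_cnj_mult)
  then show ?thesis
    using assms by (intro inv_equality) (auto simp: isom_nil_def)
qed

lemma isonil_param_closed: "isonil_param \<eta> \<in> carrier isom_nil"
  by (cases \<eta>) (auto simp: isom_nil_def)

text \<open>The rotation \<open>u\<close> cancels against its inverse in the last factor, leaving
  \<open>cis r\<close> acting on \<open>w\<close>. As \<open>Arg\<close> is not involved, the
  formula holds for every angle.\<close>

lemma conj_isonil_param:
  assumes "g \<in> carrier isom_nil"
  shows "g \<otimes>\<^bsub>isom_nil\<^esub> isonil_param \<eta> \<otimes>\<^bsub>isom_nil\<^esub> inv\<^bsub>isom_nil\<^esub> g = isonil_param (conj_coord g \<eta>)"
proof -
  obtain w t u where g: "g = ((w, t), u)" "cmod u = 1"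
    using assms by (auto simp: isom_nil_def)
  obtain x y z r where \<eta>: "\<eta> = (x, y, z, r)"
    by (cases \<eta>)
  have u: "u * cnj u = 1"
    using g(2) by (metis complex_norm_square of_real_1 one_power2)
  have uw: "(u * cis r) * (- (cnj u * w)) = - (cis r * w)" and uw': "u * cis r * cnj u = cis r"
    using u by (simp_all add: mult_ac)
  have "g \<otimes>\<^bsub>isom_nil\<^esub> isonil_param \<eta> \<otimes>\<^bsub>isom_nil\<^esub> inv\<^bsub>isom_nil\<^esub> g =
    ((w + u * Complex x y + (u * cis r) * (- (cnj u * w)),
      t + z + Im (cnj w * (u * Complex x y)) / 2 - t
        + Im (cnj (w + u * Complex x y) * ((u * cis r) * (- (cnj u * w)))) / 2), u * cis r * cnj u)"
    unfolding g \<eta> isonil_inv[OF g(2)] by (simp add: isom_nil_def)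
  also have "\<dots> = isonil_param (conj_coord g \<eta>)"
    unfolding uw uw' by (simp add: g \<eta> conj_coord_def Let_def complex_eq_iff) (simp add: field_simps)
  finally show ?thesis .
qed

lemma mult_isonil_param:
  "isonil_param \<eta> \<otimes>\<^bsub>isom_nil\<^esub> isonil_param \<eta>' = isonil_param (mult_coord \<eta> \<eta>')"
  by (cases \<eta>; cases \<eta>')
     (simp add: isom_nil_def mult_coord_def complex_eq_iff cos_add sin_add Let_def algebra_simps)

text \<open>The open coordinate range on which \<open>isonil_chart\<close> inverts
  \<open>isonil_param\<close>. The endpoint \<open>pi\<close>, which \<open>Arg\<close> attains, is
  the excluded rotation \<open>- 1\<close>.\<close>

definition strip :: "lie set" where
  "strip = {(x, y, z, r) |x y z r. \<bar>r\<bar> < pi}"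

lemma open_strip: "open strip"
proof -
  have eq: "strip = (\<lambda>\<eta>. snd (snd (snd \<eta>))) -` {- pi<..<pi}"
    by (auto simp: strip_def abs_less_iff)
  show ?thesis
    unfolding eq by (intro open_vimage continuous_intros)
qed

lemma isonil_chart_param:
  assumes "\<eta> \<in> strip"
  shows "snd isonil_chart (isonil_param \<eta>) = \<eta>"
  using assms by (auto simp: strip_def isonil_chart_def intro!: cis_Arg_unique)

lemma isonil_chart_domain: "fst isonil_chart = isonil_param ` strip"
proof (intro equalityI subsetI)
  fix g assume "g \<in> fst isonil_chart"
  then obtain w z u where g: "g = ((w, z), u)" "cmod u = 1" "u \<noteq> - 1"
    by (auto simp: isonil_chart_def)
  have "u \<noteq> 0" using g(2) by auto
  have u: "cis (Arg u) = u"
    using g(2) cis_Arg[OF \<open>u \<noteq> 0\<close>] by (simp add: sgn_div_norm)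
  have "Arg u \<noteq> pi"
    using u g(3) by auto
  then have "\<bar>Arg u\<bar> < pi"
    using Arg_bounded[of u] by linarith
  then have "isonil_param (Re w, Im w, z, Arg u) = g" "(Re w, Im w, z, Arg u) \<in> strip"
    using u g by (auto simp: strip_def)
  then show "g \<in> isonil_param ` strip" by (metis imageI)
next
  fix g assume "g \<in> isonil_param ` strip"
  then obtain x y z r where r: "g = isonil_param (x, y, z, r)" "\<bar>r\<bar> < pi"
    by (auto simp: strip_def)
  have "Arg (cis r) = r" "Arg (cis pi) = pi"
    using r(2) by (auto intro!: cis_Arg_unique)
  then have "cis r \<noteq> - 1"
    using r(2) cis_pi by auto
  then show "g \<in> fst isonil_chart"
    using r by (auto simp: isonil_chart_def)
qed

text \<open>Rotations commute, so conjugation fixes the angle, the one coordinate bounded by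
  \<open>strip\<close>.\<close>

lemma conj_coord_strip: "\<eta> \<in> strip \<Longrightarrow> conj_coord g \<eta> \<in> strip"
  by (auto simp: strip_def conj_coord_def Let_def split: prod.splits)

section \<open>The adjoint representation in coordinates\<close>

lemma differentiable_conj_coord: "conj_coord g differentiable (at \<eta>)"
proof -
  obtain w t u where g: "g = ((w, t), u)" by (metis surj_pair)
  show ?thesis
    unfolding differentiable_def g conj_coord_def case_prod_unfold Let_def fst_conv snd_conv
    by (rule exI, (rule derivative_eq_intros refl | simp)+)
qed

text \<open>To first order in \<open>r\<close>, the difference of \<open>w\<close> and
  \<open>cis r * w\<close> is \<open>- \<i> * r * w\<close>, which gives the terms in
  \<open>Im w\<close> and \<open>- Re w\<close>; the Z component collects both central terms of the
  product.\<close>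

lemma has_derivative_conj_coord:
  "(conj_coord ((w, t), u) has_derivative (\<lambda>(x, y, z, r).
     let X = Re u * x - Im u * y; Y = Re u * y + Im u * x
     in (X + r * Im w, Y - r * Re w, z + Re w * Y - Im w * X - r * ((Re w)\<^sup>2 + (Im w)\<^sup>2) / 2, r))) (at 0)"
  unfolding conj_coord_def case_prod_unfold Let_def fst_conv snd_conv
  by (rule derivative_eq_intros refl | simp)+ (auto simp: fun_eq_iff field_simps power2_eq_square)

text \<open>On the open set \<open>strip\<close> the chart inverts the parametrization, so the map
  differentiated in \<open>Ad\<close> agrees there with \<open>conj_coord\<close>.\<close>

lemma Ad_eq:
  assumes "cmod u = 1"
  shows "Ad ((w, t), u) (x, y, z, r) =
    (let X = Re u * x - Im u * y; Y = Re u * y + Im u * x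
     in (X + r * Im w, Y - r * Re w, z + Re w * Y - Im w * X - r * ((Re w)\<^sup>2 + (Im w)\<^sup>2) / 2, r))"
proof -
  let ?g = "((w, t), u)"
  have "?g \<in> carrier isom_nil"
    using assms by (simp add: isom_nil_def)
  then have "snd isonil_chart (?g \<otimes>\<^bsub>isom_nil\<^esub> isonil_param \<eta> \<otimes>\<^bsub>isom_nil\<^esub> inv\<^bsub>isom_nil\<^esub> ?g) = conj_coord ?g \<eta>"
    if "\<eta> \<in> strip" for \<eta>
    using that by (simp add: conj_isonil_param isonil_chart_param conj_coord_strip)
  moreover have "(0 :: lie) \<in> strip"
    by (simp add: strip_def zero_prod_def)
  ultimately have "((\<lambda>\<eta>. snd isonil_chart (?g \<otimes>\<^bsub>isom_nil\<^esub> isonil_param \<eta> \<otimes>\<^bsub>isom_nil\<^esub> inv\<^bsub>isom_nil\<^esub> ?g))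
      has_derivative (\<lambda>(x, y, z, r).
        let X = Re u * x - Im u * y; Y = Re u * y + Im u * x
        in (X + r * Im w, Y - r * Re w, z + Re w * Y - Im w * X - r * ((Re w)\<^sup>2 + (Im w)\<^sup>2) / 2, r))) (at 0)"
    using has_derivative_transform_within_open[OF has_derivative_conj_coord open_strip] by auto
  from frechet_derivative_at[OF this, symmetric] show ?thesis
    unfolding Ad_def by simp
qed

lemma differentiable_mult_coord: "mult_coord \<eta> differentiable (at \<eta>')"
  unfolding differentiable_def mult_coord_def case_prod_unfold Let_def
  by (rule exI, (rule derivative_eq_intros refl | simp)+)

text \<open>On the X, Y, R components \<open>Ad g\<close> is a rotation combined with a shear by
  \<open>r\<close>, hence has determinant 1 and preserves the triple product.\<close>

lemma inv_poly_bracket_Ad: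
  assumes "g \<in> carrier isom_nil"
  shows "inv_poly c1 c2 (Ad g \<xi>) (lie_bracket (Ad g \<eta>) (Ad g \<zeta>)) = inv_poly c1 c2 \<xi> (lie_bracket \<eta> \<zeta>)"
proof -
  obtain w t u where g: "g = ((w, t), u)" "cmod u = 1"
    using assms by (auto simp: isom_nil_def)
  define a b p q where ab: "a = Re u" "b = Im u" "p = Re w" "q = Im w"
  have u: "a * a + b * b = 1"
    using g(2) by (simp add: ab cmod_def power2_eq_square real_sqrt_eq_1_iff)
  obtain x y z r x' y' z' r' x'' y'' z'' r''
    where *: "\<xi> = (x, y, z, r)" "\<eta> = (x', y', z', r')" "\<zeta> = (x'', y'', z'', r'')"
    by (metis surj_pair)
  show ?thesis
    unfolding g * Ad_eq[OF g(2)] Let_def inv_poly_bracket ab[symmetric]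
    using u by algebra
qed

section \<open>Universal cover and charts of the flat bundle\<close>

lemma path_class_eq:
  assumes "homotopic_paths UNIV p q"
  shows "path_class p = path_class q"
  using assms unfolding path_class_def
  by (blast intro: homotopic_paths_trans homotopic_paths_sym)

lemma path_class_self: "path p \<Longrightarrow> p \<in> path_class p"
  by (simp add: path_class_def)

lemma in_path_class_join:
  assumes "p \<in> path_class l" "homotopic_paths UNIV q m" "pathfinish l = pathstart m"
  shows "path_class (p +++ q) = path_class (l +++ m)"
proof (intro path_class_eq homotopic_paths_join)
  show "homotopic_paths UNIV p l"
    using assms(1) homotopic_paths_sym by (simp add: path_class_def)
  then show "pathfinish p = pathstart q"
    using assms homotopic_paths_imp_pathfinish homotopic_paths_imp_pathstart by metis
qed (rule assms(2))

text \<open>All members of the union in \<open>class_mult\<close> are the same class, since joining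
  respects homotopy with fixed endpoints.\<close>

lemma class_mult_path_class:
  assumes "path l" "path p" "pathfinish l = pathstart p"
  shows "class_mult (path_class l) (path_class p) = path_class (l +++ p)"
proof -
  have "path_class (l' +++ p') = path_class (l +++ p)" if "l' \<in> path_class l" "p' \<in> path_class p" for l' p'
    using that assms by (intro in_path_class_join) (auto simp: path_class_def intro: homotopic_paths_sym)
  then have "class_mult (path_class l) (path_class p) =
      (\<Union>l'\<in>path_class l. \<Union>p'\<in>path_class p. path_class (l +++ p))"
    unfolding class_mult_def by (intro SUP_cong refl)
  then show ?thesis
    using path_class_self[OF assms(1)] path_class_self[OF assms(2)] by auto
qed

text \<open>Homotopies of paths fix endpoints, so the chosen representative does not matter.\<close>

lemma cover_proj_path_class:
  assumes "path p"
  shows "cover_proj (path_class p) = pathfinish p"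
proof -
  have "(SOME q. q \<in> path_class p) \<in> path_class p"
    by (rule someI[where P = "\<lambda>q. q \<in> path_class p"], rule path_class_self[OF assms])
  then have "homotopic_paths UNIV p (SOME q. q \<in> path_class p)"
    unfolding path_class_def by (rule CollectD)
  from homotopic_paths_imp_pathfinish[OF this] show ?thesis
    unfolding cover_proj_def by (rule sym)
qed

text \<open>Paths are carried by \<open>\<phi>\<close> to the image of \<open>U\<close> in a normed
  space, which is again simply connected; homotopies found there are carried back by
  \<open>\<psi>\<close>.\<close>

lemma simply_connected_homotopic_paths:
  fixes U :: "'a::topological_space set" and \<phi> :: "'a \<Rightarrow> 'b::real_normed_vector"
  assumes U: "simply_connected U" and hom: "homeomorphism U (\<phi> ` U) \<phi> \<psi>"
  shows "path_connected U"
    and "\<lbrakk>path p; path_image p \<subseteq> U; path q; path_image q \<subseteq> U; pathstart q = pathstart p;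
      pathfinish q = pathfinish p\<rbrakk> \<Longrightarrow> homotopic_paths U p q"
proof -
  have c: "continuous_on U \<phi>" "continuous_on (\<phi> ` U) \<psi>" "\<And>x. x \<in> U \<Longrightarrow> \<psi> (\<phi> x) = x" "\<psi> ` \<phi> ` U = U"
    using hom by (auto simp: homeomorphism_def)
  have S: "simply_connected (\<phi> ` U)"
    by (rule simply_connected_retraction_gen[OF U c(1) refl c(2)]) (use c in auto)
  show "path_connected U"
    using path_connected_continuous_image[OF c(2) simply_connected_imp_path_connected[OF S]] c(4) by simp
  assume *: "path p" "path_image p \<subseteq> U" "path q" "path_image q \<subseteq> U" "pathstart q = pathstart p"
    "pathfinish q = pathfinish p"
  have "path (\<phi> \<circ> p)" "path (\<phi> \<circ> q)"
    using * c(1) by (auto intro!: path_continuous_image continuous_on_subset[OF c(1)])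
  moreover have "path_image (\<phi> \<circ> p) \<subseteq> \<phi> ` U" "path_image (\<phi> \<circ> q) \<subseteq> \<phi> ` U"
    using * by (simp_all add: path_image_compose image_mono)
  ultimately have "homotopic_paths (\<phi> ` U) (\<phi> \<circ> p) (\<phi> \<circ> q)"
    using S * unfolding simply_connected_eq_homotopic_paths
    by (simp add: pathstart_compose pathfinish_compose)
  then have h: "homotopic_paths U (\<psi> \<circ> (\<phi> \<circ> p)) (\<psi> \<circ> (\<phi> \<circ> q))"
    by (rule homotopic_paths_continuous_image[OF _ c(2)]) (use c in auto)
  \<comment> \<open>The round trip restores a path only on the unit interval, hence homotopy and not
    equality.\<close>
  have e: "homotopic_paths U r (\<psi> \<circ> (\<phi> \<circ> r))" if "path r" "path_image r \<subseteq> U" for r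
    using that c(3) by (intro homotopic_paths_eq) (auto simp: path_image_def subset_iff)
  show "homotopic_paths U p q"
    by (rule homotopic_paths_trans[OF e[OF *(1,2)]
          homotopic_paths_trans[OF h homotopic_paths_sym[OF e[OF *(3,4)]]]])
qed

text \<open>Path connectedness of \<open>U\<close> supplies a prolongation to \<open>x\<close>, and
  simple connectedness makes any two homotopic, so the union in \<open>cover_section\<close> is a
  single class.\<close>

lemma cover_section_path_class:
  fixes U :: "'a::topological_space set" and \<phi> :: "'a \<Rightarrow> 'b::real_normed_vector"
  assumes U: "simply_connected U" and hom: "homeomorphism U (\<phi> ` U) \<phi> \<psi>"
    and a: "a \<in> universal_cover x0" "cover_proj a \<in> U" and x: "x \<in> U"
  shows "cover_section U a x \<in> universal_cover x0" "cover_proj (cover_section U a x) = x"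
proof -
  obtain p where p: "a = path_class p" "path p" "pathstart p = x0"
    using a(1) by (auto simp: universal_cover_def)
  then have "pathfinish p \<in> U"
    using a(2) by (simp add: cover_proj_path_class)
  then obtain q where q: "path q" "path_image q \<subseteq> U" "pathstart q = pathfinish p" "pathfinish q = x"
    using simply_connected_homotopic_paths(1)[OF U hom] x by (metis path_connected_def)
  have same: "path_class (p' +++ q') = path_class (p +++ q)"
    if "p' \<in> a" "path q'" "path_image q' \<subseteq> U" "pathstart q' = pathfinish p'" "pathfinish q' = x" for p' q'
  proof (rule in_path_class_join)
    have "pathfinish p' = pathfinish p"
      using that(1) homotopic_paths_imp_pathfinish[of UNIV p p'] by (simp add: p path_class_def)
    then have "homotopic_paths U q' q"
      using that q by (intro simply_connected_homotopic_paths(2)[OF U hom]) auto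
    then show "homotopic_paths UNIV q' q"
      by (rule homotopic_paths_subset) simp
  qed (use that p q in auto)
  have "cover_section U a x = (\<Union>p'\<in>a. \<Union>q'\<in>{q. path q \<and> path_image q \<subseteq> U \<and>
      pathstart q = pathfinish p' \<and> pathfinish q = x}. path_class (p +++ q))"
    unfolding cover_section_def by (intro SUP_cong refl, elim CollectE conjE, rule same)
  moreover have "p \<in> a"
    unfolding p by (rule path_class_self[OF p(2)])
  ultimately have eq: "cover_section U a x = path_class (p +++ q)"
    using q by (intro equalityI subsetI) blast+
  have "path (p +++ q)" "pathstart (p +++ q) = x0" "pathfinish (p +++ q) = x"
    using p q by auto
  then show "cover_section U a x \<in> universal_cover x0" "cover_proj (cover_section U a x) = x"
    unfolding eq by (auto simp: universal_cover_def cover_proj_path_class)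
qed

text \<open>Deck transformations preserve fibres: a loop put in front changes neither the start nor
  the end of a path.\<close>

lemma class_mult_universal_cover:
  assumes "\<gamma> \<in> carrier (fundamental_group x0)" "a \<in> universal_cover x0"
  shows "class_mult \<gamma> a \<in> universal_cover x0" "cover_proj (class_mult \<gamma> a) = cover_proj a"
proof -
  obtain l p where *: "\<gamma> = path_class l" "path l" "pathstart l = x0" "pathfinish l = x0"
    "a = path_class p" "path p" "pathstart p = x0"
    using assms by (auto simp: universal_cover_def fundamental_group_def)
  then have eq: "class_mult \<gamma> a = path_class (l +++ p)"
    by (simp add: class_mult_path_class)
  show "class_mult \<gamma> a \<in> universal_cover x0"
    using * unfolding eq universal_cover_def by (auto intro!: exI[of _ "l +++ p"])
  show "cover_proj (class_mult \<gamma> a) = cover_proj a"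
    unfolding eq using * by (simp add: cover_proj_path_class)
qed

section \<open>Orbits, right action and charts of the flat bundle\<close>

abbreviation (input) orbit :: "'m::topological_space \<Rightarrow> ((real \<Rightarrow> 'm) set \<Rightarrow> isonil) \<Rightarrow> (real \<Rightarrow> 'm) set \<Rightarrow> isonil \<Rightarrow> 'm flat_pt"
  where "orbit x0 \<rho> a g \<equiv> flat_rel x0 \<rho> `` {(a, g)}"

lemma orbit_eq:
  assumes "a \<in> universal_cover x0" "g \<in> carrier isom_nil"
  shows "orbit x0 \<rho> a g = (\<lambda>\<gamma>. (class_mult \<gamma> a, \<rho> \<gamma> \<otimes>\<^bsub>isom_nil\<^esub> g)) ` carrier (fundamental_group x0)"
  unfolding flat_rel_def using assms by blast

text \<open>The constant loop makes the orbit nonempty, so \<open>SOME\<close> picks a member, and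
  all members lie over the same point.\<close>

lemma flat_proj_orbit:
  assumes "a \<in> universal_cover x0" "g \<in> carrier isom_nil"
  shows "flat_proj (orbit x0 \<rho> a g) = cover_proj a"
proof -
  have "path_class (\<lambda>_. x0) \<in> carrier (fundamental_group x0)"
    unfolding fundamental_group_def
    by (auto intro!: exI[of _ "\<lambda>_. x0"] simp: path_def pathstart_def pathfinish_def)
  then have ne: "orbit x0 \<rho> a g \<noteq> {}"
    unfolding orbit_eq[OF assms] by blast
  have "(SOME z. z \<in> orbit x0 \<rho> a g) \<in> orbit x0 \<rho> a g"
    using ne by (rule some_in_eq[THEN iffD2])
  then show ?thesis
    unfolding flat_proj_def
    by (subst (asm) (2) orbit_eq[OF assms]) (auto simp: class_mult_universal_cover(2)[OF _ assms(1)])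
qed

text \<open>By associativity, right translation by \<open>h\<close> commutes with left translation
  by \<open>\<rho> \<gamma>\<close>.\<close>

lemma flat_act_orbit:
  assumes \<rho>: "\<rho> \<in> hom (fundamental_group x0) isom_nil"
    and a: "a \<in> universal_cover x0" and g: "g \<in> carrier isom_nil" and h: "h \<in> carrier isom_nil"
  shows "flat_act (orbit x0 \<rho> a g) h = orbit x0 \<rho> a (g \<otimes>\<^bsub>isom_nil\<^esub> h)"
proof -
  interpret group isom_nil by (rule group_isom_nil)
  have "\<rho> \<gamma> \<in> carrier isom_nil" if "\<gamma> \<in> carrier (fundamental_group x0)" for \<gamma>
    using \<rho> that by (rule hom_in_carrier)
  then show ?thesis
    unfolding orbit_eq[OF a g] orbit_eq[OF a m_closed[OF g h]] flat_act_def image_image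
    using g h by (auto simp: m_assoc intro!: image_cong)
qed

text \<open>\<open>d\<close> is the chart of the flat bundle that has coordinates \<open>(\<phi> x, \<eta>)\<close> at the orbit of
  \<open>(\<sigma> x, h \<cdot> isonil_param \<eta>)\<close>, where \<open>\<sigma>\<close> is a section of the universal cover over \<open>U\<close>.\<close>

definition flat_chart ::
    "'m::topological_space \<Rightarrow> ((real \<Rightarrow> 'm) set \<Rightarrow> isonil) \<Rightarrow> ('m flat_pt, 'e \<times> lie) chart \<Rightarrow> 'm set \<Rightarrow>
     ('m \<Rightarrow> 'e) \<Rightarrow> ('m \<Rightarrow> (real \<Rightarrow> 'm) set) \<Rightarrow> isonil \<Rightarrow> bool" where
  "flat_chart x0 \<rho> d U \<phi> \<sigma> h \<longleftrightarrow>
     h \<in> carrier isom_nil \<and> (\<forall>x\<in>U. \<sigma> x \<in> universal_cover x0 \<and> cover_proj (\<sigma> x) = x) \<and>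
     fst d = (\<lambda>(x, \<eta>). orbit x0 \<rho> (\<sigma> x) (h \<otimes>\<^bsub>isom_nil\<^esub> isonil_param \<eta>)) ` (U \<times> strip) \<and>
     (\<forall>x\<in>U. \<forall>\<eta>\<in>strip. snd d (orbit x0 \<rho> (\<sigma> x) (h \<otimes>\<^bsub>isom_nil\<^esub> isonil_param \<eta>)) = (\<phi> x, \<eta>))"

lemma isonil_atlas_memI:
  assumes "h \<in> carrier isom_nil"
  shows "((\<lambda>\<eta>. h \<otimes>\<^bsub>isom_nil\<^esub> isonil_param \<eta>) ` strip,
      \<lambda>g. snd isonil_chart (inv\<^bsub>isom_nil\<^esub> h \<otimes>\<^bsub>isom_nil\<^esub> g)) \<in> isonil_atlas"
  unfolding isonil_atlas_def isonil_chart_domain image_image using assms by blast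

text \<open>Injectivity on \<open>W\<close> recovers from an orbit its representative over
  \<open>\<sigma> x\<close>; cancelling \<open>h\<close> leaves \<open>isonil_param \<eta>\<close>,
  whose chart value is \<open>\<eta>\<close>.\<close>

lemma flat_chart_quotient:
  assumes h: "h \<in> carrier isom_nil"
    and \<sigma>: "\<And>x. x \<in> U \<Longrightarrow> \<sigma> x \<in> universal_cover x0 \<and> cover_proj (\<sigma> x) = x"
    and W: "W = \<sigma> ` U \<times> (\<lambda>\<eta>. h \<otimes>\<^bsub>isom_nil\<^esub> isonil_param \<eta>) ` strip"
    and inj: "inj_on (\<lambda>z. flat_rel x0 \<rho> `` {z}) W"
  shows "flat_chart x0 \<rho> ((\<lambda>z. flat_rel x0 \<rho> `` {z}) ` W,
    map_prod (\<phi> \<circ> cover_proj) (\<lambda>g. snd isonil_chart (inv\<^bsub>isom_nil\<^esub> h \<otimes>\<^bsub>isom_nil\<^esub> g)) \<circ>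
      the_inv_into W (\<lambda>z. flat_rel x0 \<rho> `` {z})) U \<phi> \<sigma> h"
proof -
  interpret group isom_nil by (rule group_isom_nil)
  have 1: "(\<lambda>z. flat_rel x0 \<rho> `` {z}) ` W =
      (\<lambda>(x, \<eta>). orbit x0 \<rho> (\<sigma> x) (h \<otimes>\<^bsub>isom_nil\<^esub> isonil_param \<eta>)) ` (U \<times> strip)"
    unfolding W image_paired_Times[symmetric] image_image by (simp add: case_prod_unfold)
  have 2: "the_inv_into W (\<lambda>z. flat_rel x0 \<rho> `` {z}) (orbit x0 \<rho> (\<sigma> x) (h \<otimes>\<^bsub>isom_nil\<^esub> isonil_param \<eta>)) =
      (\<sigma> x, h \<otimes>\<^bsub>isom_nil\<^esub> isonil_param \<eta>)" if "x \<in> U" "\<eta> \<in> strip" for x \<eta>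
    by (rule the_inv_into_f_f[OF inj]) (use that W in auto)
  have 3: "inv\<^bsub>isom_nil\<^esub> h \<otimes>\<^bsub>isom_nil\<^esub> (h \<otimes>\<^bsub>isom_nil\<^esub> isonil_param \<eta>) = isonil_param \<eta>" for \<eta>
    using h by (simp add: isonil_param_closed m_assoc[symmetric])
  show ?thesis
    unfolding flat_chart_def using h \<sigma> by (simp add: 1 2 3 isonil_chart_param)
qed

text \<open>Conjugation preserves the domain of the chart of the group at the identity, so right translates of
  chart domains are chart domains. This moves a chart of the bundle along the fibre.\<close>

lemma flat_atlas_chart:
  fixes A :: "('m::topological_space, 'e::euclidean_space) chart set"
  assumes A: "smooth_manifold A" and \<rho>: "\<rho> \<in> hom (fundamental_group x0) isom_nil"
    and d: "d \<in> flat_atlas A x0 \<rho>"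
  obtains U V \<phi> \<sigma> h where "(V, \<phi>) \<in> A" "U \<subseteq> V" "open U" "flat_chart x0 \<rho> d U \<phi> \<sigma> h"
    "\<And>k. k \<in> carrier isom_nil \<Longrightarrow>
      \<exists>d'\<in>flat_atlas A x0 \<rho>. flat_chart x0 \<rho> d' U \<phi> \<sigma> (h \<otimes>\<^bsub>isom_nil\<^esub> k)"
proof -
  interpret group isom_nil by (rule group_isom_nil)
  let ?q = "\<lambda>z. flat_rel x0 \<rho> `` {z}"
  let ?L = "\<lambda>h. (\<lambda>\<eta>. h \<otimes>\<^bsub>isom_nil\<^esub> isonil_param \<eta>) ` strip"
  let ?\<psi> = "\<lambda>h g. snd isonil_chart (inv\<^bsub>isom_nil\<^esub> h \<otimes>\<^bsub>isom_nil\<^esub> g)"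
  obtain W1 W2 \<phi>1 \<psi>1 where 1: "d = (?q ` (W1 \<times> W2), map_prod \<phi>1 \<psi>1 \<circ> the_inv_into (W1 \<times> W2) ?q)"
    "(W1, \<phi>1) \<in> cover_atlas A x0" "(W2, \<psi>1) \<in> isonil_atlas" "inj_on ?q (W1 \<times> W2)"
    using d unfolding flat_atlas_def quotient_atlas_def product_atlas_def by blast
  obtain U V \<phi> a where 2: "W1 = cover_section U a ` U" "\<phi>1 = \<phi> \<circ> cover_proj" "(V, \<phi>) \<in> A" "U \<subseteq> V" "open U"
    "simply_connected U" "a \<in> universal_cover x0" "cover_proj a \<in> U"
    using 1(2) unfolding cover_atlas_def by blast
  obtain h where 3: "h \<in> carrier isom_nil" "W2 = ?L h" "\<psi>1 = ?\<psi> h"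
    using 1(3) unfolding isonil_atlas_def isonil_chart_domain image_image by blast
  let ?\<sigma> = "cover_section U a"
  have "homeomorphism V (\<phi> ` V) \<phi> (the_inv_into V \<phi>)"
    using A 2(3) unfolding smooth_manifold_def by fastforce
  then have "homeomorphism U (\<phi> ` U) \<phi> (the_inv_into V \<phi>)"
    by (rule homeomorphism_of_subsets) (use 2(4) in auto)
  note \<sigma> = cover_section_path_class[OF 2(6) this 2(7,8)]
  have chart: "flat_chart x0 \<rho> d U \<phi> ?\<sigma> h"
    unfolding 1(1) 2(2) 3(3)
    by (rule flat_chart_quotient[OF 3(1) _ _ 1(4)]) (simp_all add: \<sigma> 2(1) 3(2))
  have "\<exists>d'\<in>flat_atlas A x0 \<rho>. flat_chart x0 \<rho> d' U \<phi> ?\<sigma> (h \<otimes>\<^bsub>isom_nil\<^esub> k)" if k: "k \<in> carrier isom_nil" for k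
  proof -
    let ?W = "W1 \<times> ?L (h \<otimes>\<^bsub>isom_nil\<^esub> k)"
    have shift: "h \<otimes>\<^bsub>isom_nil\<^esub> k \<otimes>\<^bsub>isom_nil\<^esub> isonil_param \<eta> \<otimes>\<^bsub>isom_nil\<^esub> inv\<^bsub>isom_nil\<^esub> k \<in> W2" if "\<eta> \<in> strip" for \<eta>
    proof -
      have "h \<otimes>\<^bsub>isom_nil\<^esub> k \<otimes>\<^bsub>isom_nil\<^esub> isonil_param \<eta> \<otimes>\<^bsub>isom_nil\<^esub> inv\<^bsub>isom_nil\<^esub> k =
          h \<otimes>\<^bsub>isom_nil\<^esub> isonil_param (conj_coord k \<eta>)"
        using 3(1) k by (simp add: conj_isonil_param[symmetric] isonil_param_closed m_assoc)
      then show ?thesis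
        using that by (simp add: 3(2) conj_coord_strip)
    qed
    \<comment> \<open>Right translation by the inverse of \<open>k\<close> carries \<open>?W\<close>
      into \<open>W1 \<times> W2\<close>, where the quotient map is injective, and respects
      orbits.\<close>
    have inj: "inj_on ?q ?W"
    proof (rule inj_onI)
      fix z z' assume z: "z \<in> ?W" "z' \<in> ?W" "?q z = ?q z'"
      obtain b g b' g' where zz: "z = (b, g)" "z' = (b', g')" by (metis surj_pair)
      obtain \<eta> \<eta>' where "g = h \<otimes>\<^bsub>isom_nil\<^esub> k \<otimes>\<^bsub>isom_nil\<^esub> isonil_param \<eta>"
          "g' = h \<otimes>\<^bsub>isom_nil\<^esub> k \<otimes>\<^bsub>isom_nil\<^esub> isonil_param \<eta>'"
        using z(1,2) unfolding zz by blast
      then have g: "g \<in> carrier isom_nil" "g' \<in> carrier isom_nil"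
        using 3(1) k by (simp_all add: isonil_param_closed)
      have b: "b \<in> universal_cover x0" "b' \<in> universal_cover x0"
        using z(1,2) \<sigma>(1) by (auto simp: zz 2(1))
      have ki: "inv\<^bsub>isom_nil\<^esub> k \<in> carrier isom_nil" using k by simp
      have "?q (b, g \<otimes>\<^bsub>isom_nil\<^esub> inv\<^bsub>isom_nil\<^esub> k) = ?q (b', g' \<otimes>\<^bsub>isom_nil\<^esub> inv\<^bsub>isom_nil\<^esub> k)"
        using z(3) flat_act_orbit[OF \<rho> b(1) g(1) ki] flat_act_orbit[OF \<rho> b(2) g(2) ki] by (simp add: zz)
      moreover have "(b, g \<otimes>\<^bsub>isom_nil\<^esub> inv\<^bsub>isom_nil\<^esub> k) \<in> W1 \<times> W2" "(b', g' \<otimes>\<^bsub>isom_nil\<^esub> inv\<^bsub>isom_nil\<^esub> k) \<in> W1 \<times> W2"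
        using z(1,2) shift by (auto simp: zz)
      ultimately have "b = b'" "g \<otimes>\<^bsub>isom_nil\<^esub> inv\<^bsub>isom_nil\<^esub> k = g' \<otimes>\<^bsub>isom_nil\<^esub> inv\<^bsub>isom_nil\<^esub> k"
        using inj_onD[OF 1(4)] by blast+
      then show "z = z'"
        using g ki by (simp add: zz)
    qed
    have hk: "h \<otimes>\<^bsub>isom_nil\<^esub> k \<in> carrier isom_nil" using 3(1) k by simp
    let ?d = "(?q ` ?W, map_prod \<phi>1 (?\<psi> (h \<otimes>\<^bsub>isom_nil\<^esub> k)) \<circ> the_inv_into ?W ?q)"
    have "(?W, map_prod \<phi>1 (?\<psi> (h \<otimes>\<^bsub>isom_nil\<^esub> k))) \<in> product_atlas (cover_atlas A x0) isonil_atlas"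
      unfolding product_atlas_def using 1(2) isonil_atlas_memI[OF hk] by blast
    then have "?d \<in> flat_atlas A x0 \<rho>"
      unfolding flat_atlas_def quotient_atlas_def using inj by blast
    moreover have "flat_chart x0 \<rho> ?d U \<phi> ?\<sigma> (h \<otimes>\<^bsub>isom_nil\<^esub> k)"
      unfolding 2(2) by (rule flat_chart_quotient[OF hk _ _ inj]) (simp_all add: \<sigma> 2(1))
    ultimately show ?thesis by blast
  qed
  with that[OF 2(3-5) chart] show thesis by blast
qed

text \<open>The right action is transitive on the fibres of the product bundle, and the
  trivialization is equivariant.\<close>

lemma flat_bundle_orbits:
  assumes triv: "flat_bundle_trivial A x0 \<rho>"
    and u: "u \<in> flat_bundle x0 \<rho>" "v \<in> flat_bundle x0 \<rho>" "flat_proj u = flat_proj v"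
  obtains k where "k \<in> carrier isom_nil" "v = flat_act u k" "u = flat_act v (inv\<^bsub>isom_nil\<^esub> k)"
proof -
  interpret group isom_nil by (rule group_isom_nil)
  obtain \<Phi> where \<Phi>: "bij_betw \<Phi> (UNIV \<times> carrier isom_nil) (flat_bundle x0 \<rho>)"
    "\<And>x g. g \<in> carrier isom_nil \<Longrightarrow> flat_proj (\<Phi> (x, g)) = x"
    "\<And>x g h. g \<in> carrier isom_nil \<Longrightarrow> h \<in> carrier isom_nil \<Longrightarrow>
      \<Phi> (x, g \<otimes>\<^bsub>isom_nil\<^esub> h) = flat_act (\<Phi> (x, g)) h"
    using triv unfolding flat_bundle_trivial_def by blast
  have surj: "\<exists>g\<in>carrier isom_nil. w = \<Phi> (flat_proj w, g)" if "w \<in> flat_bundle x0 \<rho>" for w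
    using that \<Phi>(2) unfolding bij_betw_imp_surj_on[OF \<Phi>(1), symmetric] by auto
  obtain g g' where g: "g \<in> carrier isom_nil" "u = \<Phi> (flat_proj v, g)"
      "g' \<in> carrier isom_nil" "v = \<Phi> (flat_proj v, g')"
    using surj[OF u(1)] surj[OF u(2)] u(3) by auto
  let ?k = "inv\<^bsub>isom_nil\<^esub> g \<otimes>\<^bsub>isom_nil\<^esub> g'"
  have k: "?k \<in> carrier isom_nil" "inv\<^bsub>isom_nil\<^esub> ?k \<in> carrier isom_nil" using g by auto
  have "g \<otimes>\<^bsub>isom_nil\<^esub> ?k = g'" "g' \<otimes>\<^bsub>isom_nil\<^esub> inv\<^bsub>isom_nil\<^esub> ?k = g"
    using g by (simp_all add: m_assoc[symmetric] inv_mult_group)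
  then have "v = flat_act u ?k" "u = flat_act v (inv\<^bsub>isom_nil\<^esub> ?k)"
    using \<Phi>(3)[OF g(1) k(1), of "flat_proj v"] \<Phi>(3)[OF g(3) k(2), of "flat_proj v"] g by metis+
  with that k show thesis by blast
qed

section \<open>The Chern--Simons form of flat connections\<close>

lemma lie_bracket_bilinear:
  "lie_bracket (\<xi> + \<xi>') \<eta> = lie_bracket \<xi> \<eta> + lie_bracket \<xi>' \<eta>"
  "lie_bracket \<eta> (\<xi> + \<xi>') = lie_bracket \<eta> \<xi> + lie_bracket \<eta> \<xi>'"
  "lie_bracket (\<xi> - \<xi>') \<eta> = lie_bracket \<xi> \<eta> - lie_bracket \<xi>' \<eta>"
  "lie_bracket \<eta> (\<xi> - \<xi>') = lie_bracket \<eta> \<xi> - lie_bracket \<eta> \<xi>'"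
  by (cases \<xi>; cases \<xi>'; cases \<eta>; simp add: algebra_simps)+

lemma lie_bracket_antisym: "lie_bracket \<eta> \<xi> = - lie_bracket \<xi> \<eta>"
  by (cases \<xi>; cases \<eta>) simp

text \<open>Antisymmetry of the bracket doubles its value in the wedge, which cancels the factor
  1/2.\<close>

lemma curvature_eq:
  "curvature \<omega> d z v w = ext_d1 \<omega> d z v w + lie_bracket (\<omega> d z v) (\<omega> d z w)"
  unfolding curvature_def wedge11_def
  by (simp add: lie_bracket_antisym[of "\<omega> d z w"] scaleR_2[symmetric])

lemma ext_d1_diff:
  assumes "\<And>v. (\<lambda>y. \<omega> d y v) differentiable (at z)" "\<And>v. (\<lambda>y. \<tau> d y v) differentiable (at z)"
  shows "ext_d1 (form1_diff \<omega> \<tau>) d z v w = ext_d1 \<omega> d z v w - ext_d1 \<tau> d z v w"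
proof -
  have "frechet_derivative (\<lambda>y. \<omega> d y v - \<tau> d y v) (at z) =
      (\<lambda>u. frechet_derivative (\<lambda>y. \<omega> d y v) (at z) u - frechet_derivative (\<lambda>y. \<tau> d y v) (at z) u)" for v
    by (intro frechet_derivative_at[symmetric] has_derivative_diff)
       (use assms frechet_derivative_works in blast)+
  then show ?thesis
    by (simp add: ext_d1_def form1_diff_def)
qed

text \<open>Let T be the triple product of the three values of the difference. By cyclic symmetry
  the covariant derivative contributes -3T and the cubic term 6T/3; the curvature term vanishes,
  leaving -T.\<close>

lemma CS_upstairs_flat:
  assumes diff: "\<And>v. (\<lambda>y. \<omega>1 d y v) differentiable (at z)" "\<And>v. (\<lambda>y. \<omega>0 d y v) differentiable (at z)"
    and flat: "\<And>v w. curvature \<omega>1 d z v w = 0" "\<And>v w. curvature \<omega>0 d z v w = 0"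
  shows "CS_upstairs (inv_poly c1 c2) \<omega>1 \<omega>0 d z v1 v2 v3 =
    - inv_poly c1 c2 (form1_diff \<omega>1 \<omega>0 d z v1)
        (lie_bracket (form1_diff \<omega>1 \<omega>0 d z v2) (form1_diff \<omega>1 \<omega>0 d z v3))"
proof -
  let ?a = "form1_diff \<omega>1 \<omega>0"
  have d: "ext_d1 \<omega>1 d z v w = - lie_bracket (\<omega>1 d z v) (\<omega>1 d z w)"
    "ext_d1 \<omega>0 d z v w = - lie_bracket (\<omega>0 d z v) (\<omega>0 d z w)" for v w
    using flat[of v w] by (simp_all add: curvature_eq eq_neg_iff_add_eq_0)
  \<comment> \<open>Substituting \<open>\<omega>1\<close> as \<open>\<omega>0\<close> plus
    \<open>?a\<close> into the two flatness equations, the mixed brackets cancel against the wedge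
    with \<open>\<omega>0\<close>.\<close>
  have cov: "cov_d \<omega>0 ?a d z v w = - lie_bracket (?a d z v) (?a d z w)" for v w
    unfolding cov_d_def wedge11_def ext_d1_diff[of \<omega>1 d z \<omega>0, OF diff] d
    by (simp add: form1_diff_def lie_bracket_bilinear lie_bracket_antisym[of "\<omega>0 d z w"] algebra_simps)
  obtain x y s r x' y' s' r' x'' y'' s'' r'' where *:
    "?a d z v1 = (x, y, s, r)" "?a d z v2 = (x', y', s', r')" "?a d z v3 = (x'', y'', s'', r'')"
    by (metis surj_pair)
  show ?thesis
    unfolding CS_upstairs_def Let_def wedge12_def cov flat(2) wedge11_def *
    by (simp add: zero_prod_def algebra_simps)
qed

lemma ext_d2_wedge_flat:
  fixes aX aY aZ aR :: "('m, 'e::euclidean_space, real) form1"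
  defines "\<alpha> \<equiv> (\<lambda>c y v. aX c y v *\<^sub>R lie_X + aY c y v *\<^sub>R lie_Y + aZ c y v *\<^sub>R lie_Z + aR c y v *\<^sub>R lie_R)"
  assumes diff: "\<And>v. (\<lambda>y. \<alpha> c y v) differentiable (at y)"
    and flat: "\<And>v w. curvature \<alpha> c y v w = 0"
  shows "c1 * ext_d2 (wedge11 (*) aZ aR) c y v1 v2 v3 =
    - inv_poly c1 c2 (\<alpha> c y v1) (lie_bracket (\<alpha> c y v2) (\<alpha> c y v3))"
proof -
  have \<alpha>: "\<alpha> c y v = (aX c y v, aY c y v, aZ c y v, aR c y v)" for y v
    by (simp add: \<alpha>_def lie_X_def lie_Y_def lie_Z_def lie_R_def)
  let ?D = "\<lambda>a v u. frechet_derivative (\<lambda>y. a c y v) (at y) u"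
  have D: "((\<lambda>y. \<alpha> c y v) has_derivative ?D \<alpha> v) (at y)" for v
    using diff frechet_derivative_works by blast
  \<comment> \<open>The derivatives of \<open>aZ\<close> and \<open>aR\<close> are read off as
    components of the derivative of \<open>\<alpha>\<close>, whose differentiability is
    given.\<close>
  define Z' R' where "Z' v u = fst (snd (snd (?D \<alpha> v u)))" and "R' v u = snd (snd (snd (?D \<alpha> v u)))" for v u
  have Z: "((\<lambda>y. aZ c y v) has_derivative Z' v) (at y)" and R: "((\<lambda>y. aR c y v) has_derivative R' v) (at y)" for v
    using has_derivative_fst[OF has_derivative_snd[OF has_derivative_snd[OF D]]]
      has_derivative_snd[OF has_derivative_snd[OF has_derivative_snd[OF D]]]
    unfolding Z'_def R'_def by (simp_all add: \<alpha>)
  have W: "frechet_derivative (\<lambda>y. wedge11 (*) aZ aR c y v w) (at y) =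
      (\<lambda>u. (aZ c y v * R' w u + Z' v u * aR c y w) - (aZ c y w * R' v u + Z' w u * aR c y v))" for v w
    unfolding wedge11_def
    by (intro frechet_derivative_at[symmetric] has_derivative_diff has_derivative_mult Z R)
  have sym: "?D \<alpha> w v = ?D \<alpha> v w - lie_bracket (\<alpha> c y v) (\<alpha> c y w)" for v w
  proof -
    have "?D \<alpha> w v - ?D \<alpha> v w = - lie_bracket (\<alpha> c y v) (\<alpha> c y w)"
      using flat[of v w] unfolding curvature_eq ext_d1_def by (simp only: eq_neg_iff_add_eq_0)
    then show ?thesis
      by (simp only: diff_eq_eq uminus_add_conv_diff diff_add_cancel)
  qed
  \<comment> \<open>The Z and R components of flatness; brackets have no R component, so
    \<open>R'\<close> is symmetric.\<close>
  have eq: "Z' w v = Z' v w - (aX c y v * aY c y w - aY c y v * aX c y w)" "R' w v = R' v w" for v w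
    unfolding Z'_def R'_def sym[of w v] by (simp_all add: \<alpha>)
  show ?thesis
    unfolding ext_d2_def W \<alpha> inv_poly_bracket eq[of v2 v1] eq[of v3 v1] eq[of v3 v2]
    by algebra
qed

section \<open>Connections on the flat bundle\<close>

lemma manifold_chart:
  assumes "smooth_manifold A" "(V, \<phi>) \<in> A"
  shows "inj_on \<phi> V" "open V" "\<And>U. open U \<Longrightarrow> U \<subseteq> V \<Longrightarrow> open (\<phi> ` U)"
proof -
  have h: "homeomorphism V (\<phi> ` V) \<phi> (the_inv_into V \<phi>)" and o: "open V" "open (\<phi> ` V)"
    using assms unfolding smooth_manifold_def by fastforce+
  show "inj_on \<phi> V"
    using h by (metis homeomorphism_def inj_on_inverseI)
  show "open V" by fact
  show "open (\<phi> ` U)" if "open U" "U \<subseteq> V" for U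
    using homeomorphism_imp_open_map[OF h, of U] that o by (simp add: openin_open_eq)
qed

section \<open>Coordinates in a chart of the bundle\<close>

lemma flat_chart_param:
  assumes "flat_chart x0 \<rho> d U \<phi> \<sigma> h"
  shows "h \<in> carrier isom_nil" "x \<in> U \<Longrightarrow> \<sigma> x \<in> universal_cover x0" "x \<in> U \<Longrightarrow> cover_proj (\<sigma> x) = x"
    "\<lbrakk>x \<in> U; \<eta> \<in> strip\<rbrakk> \<Longrightarrow> orbit x0 \<rho> (\<sigma> x) (h \<otimes>\<^bsub>isom_nil\<^esub> isonil_param \<eta>) \<in> fst d"
    "\<lbrakk>x \<in> U; \<eta> \<in> strip\<rbrakk> \<Longrightarrow> snd d (orbit x0 \<rho> (\<sigma> x) (h \<otimes>\<^bsub>isom_nil\<^esub> isonil_param \<eta>)) = (\<phi> x, \<eta>)"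
    "u \<in> fst d \<Longrightarrow> \<exists>x\<in>U. \<exists>\<eta>\<in>strip. u = orbit x0 \<rho> (\<sigma> x) (h \<otimes>\<^bsub>isom_nil\<^esub> isonil_param \<eta>)"
proof -
  note a = assms[unfolded flat_chart_def]
  note f = a[THEN conjunct2, THEN conjunct2, THEN conjunct1]
  show "h \<in> carrier isom_nil"
    by (rule a[THEN conjunct1])
  show "x \<in> U \<Longrightarrow> \<sigma> x \<in> universal_cover x0" "x \<in> U \<Longrightarrow> cover_proj (\<sigma> x) = x"
    using a[THEN conjunct2, THEN conjunct1] by simp_all
  show "\<lbrakk>x \<in> U; \<eta> \<in> strip\<rbrakk> \<Longrightarrow> orbit x0 \<rho> (\<sigma> x) (h \<otimes>\<^bsub>isom_nil\<^esub> isonil_param \<eta>) \<in> fst d"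
    unfolding f by (rule image_eqI[of _ _ "(x, \<eta>)"]) simp_all
  show "\<lbrakk>x \<in> U; \<eta> \<in> strip\<rbrakk> \<Longrightarrow>
      snd d (orbit x0 \<rho> (\<sigma> x) (h \<otimes>\<^bsub>isom_nil\<^esub> isonil_param \<eta>)) = (\<phi> x, \<eta>)"
    using a[THEN conjunct2, THEN conjunct2, THEN conjunct2] by blast
  show "\<exists>x\<in>U. \<exists>\<eta>\<in>strip. u = orbit x0 \<rho> (\<sigma> x) (h \<otimes>\<^bsub>isom_nil\<^esub> isonil_param \<eta>)" if "u \<in> fst d"
    using that unfolding f by (elim imageE SigmaE) (simp only: prod.case, blast)
qed

lemma flat_chart_range:
  assumes "flat_chart x0 \<rho> d U \<phi> \<sigma> h"
  shows "snd d ` fst d = \<phi> ` U \<times> strip"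
proof -
  note c = flat_chart_param[OF assms]
  show ?thesis
  proof (intro equalityI subsetI)
    fix z assume "z \<in> snd d ` fst d"
    then show "z \<in> \<phi> ` U \<times> strip"
      using c(5,6) by fastforce
  next
    fix z assume "z \<in> \<phi> ` U \<times> strip"
    then obtain x \<eta> where "z = (\<phi> x, \<eta>)" "x \<in> U" "\<eta> \<in> strip" by blast
    then show "z \<in> snd d ` fst d"
      using c(4,5)[of x \<eta>] by (metis imageI)
  qed
qed

text \<open>Equal coordinates force equal base points, by injectivity of \<open>\<phi>\<close>, and
  equal fibre parameters, so the chart map is injective.\<close>

lemma flat_chart_inverse:
  assumes chart: "flat_chart x0 \<rho> d U \<phi> \<sigma> h" and inj: "inj_on \<phi> U" and x: "x \<in> U" "\<eta> \<in> strip"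
  shows "the_inv_into (fst d) (snd d) (\<phi> x, \<eta>) = orbit x0 \<rho> (\<sigma> x) (h \<otimes>\<^bsub>isom_nil\<^esub> isonil_param \<eta>)"
proof -
  note c = flat_chart_param[OF chart]
  have "inj_on (snd d) (fst d)"
  proof (rule inj_onI)
    fix u u' assume u: "u \<in> fst d" "u' \<in> fst d" "snd d u = snd d u'"
    obtain y \<theta> where y: "y \<in> U" "\<theta> \<in> strip" "u = orbit x0 \<rho> (\<sigma> y) (h \<otimes>\<^bsub>isom_nil\<^esub> isonil_param \<theta>)"
      using c(6)[OF u(1)] by blast
    obtain y' \<theta>' where y': "y' \<in> U" "\<theta>' \<in> strip" "u' = orbit x0 \<rho> (\<sigma> y') (h \<otimes>\<^bsub>isom_nil\<^esub> isonil_param \<theta>')"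
      using c(6)[OF u(2)] by blast
    have "\<phi> y = \<phi> y'" "\<theta> = \<theta>'"
      using u(3) c(5)[OF y(1,2)] c(5)[OF y'(1,2)] unfolding y(3) y'(3) by simp_all
    then show "u = u'"
      using inj_onD[OF inj _ y(1) y'(1)] y(3) y'(3) by simp
  qed
  from the_inv_into_f_f[OF this c(4)[OF x]] show ?thesis
    unfolding c(5)[OF x] .
qed

lemma flat_chart_proj:
  assumes "flat_chart x0 \<rho> d U \<phi> \<sigma> h" "x \<in> U"
  shows "flat_proj (orbit x0 \<rho> (\<sigma> x) (h \<otimes>\<^bsub>isom_nil\<^esub> isonil_param \<eta>)) = x"
    and "orbit x0 \<rho> (\<sigma> x) (h \<otimes>\<^bsub>isom_nil\<^esub> isonil_param \<eta>) \<in> flat_bundle x0 \<rho>"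
proof -
  interpret group isom_nil by (rule group_isom_nil)
  note c = flat_chart_param[OF assms(1)]
  have g: "h \<otimes>\<^bsub>isom_nil\<^esub> isonil_param \<eta> \<in> carrier isom_nil"
    using c(1) isonil_param_closed by simp
  show "flat_proj (orbit x0 \<rho> (\<sigma> x) (h \<otimes>\<^bsub>isom_nil\<^esub> isonil_param \<eta>)) = x"
    using flat_proj_orbit[OF c(2)[OF assms(2)] g] c(3)[OF assms(2)] by simp
  show "orbit x0 \<rho> (\<sigma> x) (h \<otimes>\<^bsub>isom_nil\<^esub> isonil_param \<eta>) \<in> flat_bundle x0 \<rho>"
    unfolding flat_bundle_def by (intro quotientI SigmaI c(2)[OF assms(2)] g)
qed

lemma local_rep_chart:
  assumes "smooth_manifold A" "c \<in> A" "x \<in> fst c"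
  shows "local_rep c d f (snd c x) = snd d (f x)"
  using manifold_chart(1)[OF assms(1), of "fst c" "snd c"] assms
  by (simp add: local_rep_def the_inv_into_f_f)

text \<open>Only the fibre coordinate is involved in the fundamental vector fields; evaluating a connection
  on them shows that they exhaust the vertical vectors.\<close>

lemma connection_vertical:
  assumes \<rho>: "\<rho> \<in> hom (fundamental_group x0) isom_nil"
    and chart: "flat_chart x0 \<rho> d U \<phi> \<sigma> h" and d: "d \<in> B"
    and u: "u \<in> fst d"
    and conn: "principal_connection B flat_act \<omega>" "principal_connection B flat_act \<omega>'"
  shows "\<omega> d (snd d u) (0, \<zeta>) = \<omega>' d (snd d u) (0, \<zeta>)"
proof -
  interpret group isom_nil by (rule group_isom_nil)
  note c = flat_chart_param[OF chart]
  obtain x \<eta>0 where x: "x \<in> U" "\<eta>0 \<in> strip" "u = orbit x0 \<rho> (\<sigma> x) (h \<otimes>\<^bsub>isom_nil\<^esub> isonil_param \<eta>0)"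
    using c(6)[OF u] by blast
  let ?M = "frechet_derivative (mult_coord \<eta>0) (at 0)"
  \<comment> \<open>The displacements along the fibre that stay in the chart; \<open>0\<close> is
    among them since \<open>mult_coord \<eta>0 0 = \<eta>0\<close>.\<close>
  let ?N = "mult_coord \<eta>0 -` strip"
  have "continuous_on UNIV (mult_coord \<eta>0)"
    by (intro continuous_at_imp_continuous_on ballI differentiable_imp_continuous_within differentiable_mult_coord)
  then have N: "open ?N" "0 \<in> ?N"
    using open_vimage[OF open_strip] x(2) by (auto simp: mult_coord_def zero_prod_def Let_def split: prod.splits)
  have eq: "snd d (flat_act u (isonil_param \<eta>)) = (\<phi> x, mult_coord \<eta>0 \<eta>)" if "\<eta> \<in> ?N" for \<eta>
  proof -
    have "flat_act u (isonil_param \<eta>) =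
        orbit x0 \<rho> (\<sigma> x) (h \<otimes>\<^bsub>isom_nil\<^esub> isonil_param \<eta>0 \<otimes>\<^bsub>isom_nil\<^esub> isonil_param \<eta>)"
      unfolding x(3) by (rule flat_act_orbit[OF \<rho> c(2)[OF x(1)]]) (use c(1) isonil_param_closed in auto)
    also have "h \<otimes>\<^bsub>isom_nil\<^esub> isonil_param \<eta>0 \<otimes>\<^bsub>isom_nil\<^esub> isonil_param \<eta> =
        h \<otimes>\<^bsub>isom_nil\<^esub> isonil_param (mult_coord \<eta>0 \<eta>)"
      using c(1) by (simp add: m_assoc isonil_param_closed mult_isonil_param del: isonil_param.simps)
    finally show ?thesis
      using c(5)[OF x(1)] that by simp
  qed
  have M: "(mult_coord \<eta>0 has_derivative ?M) (at 0)"
    using differentiable_mult_coord frechet_derivative_works by blast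
  have "((\<lambda>\<eta>. (\<phi> x, mult_coord \<eta>0 \<eta>)) has_derivative (\<lambda>\<xi>. (0, ?M \<xi>))) (at 0)"
    by (intro has_derivative_Pair has_derivative_const M)
  then have "((\<lambda>\<eta>. snd d (flat_act u (isonil_param \<eta>))) has_derivative (\<lambda>\<xi>. (0, ?M \<xi>))) (at 0)"
    by (rule has_derivative_transform_within_open[OF _ N]) (simp add: eq)
  then have "fundamental_vector flat_act d u = (\<lambda>\<xi>. (0, ?M \<xi>))"
    unfolding fundamental_vector_def by (rule frechet_derivative_at[symmetric])
  then have w: "\<omega> d (snd d u) (0, ?M \<xi>) = \<xi>" "\<omega>' d (snd d u) (0, ?M \<xi>) = \<xi>" for \<xi>
    using conn d u unfolding principal_connection_def by metis+
  \<comment> \<open>The connection is a left inverse of \<open>?M\<close>; as an injective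
    endomorphism in finite dimension, \<open>?M\<close> is surjective.\<close>
  have "inj ?M"
    by (rule injI) (metis w(1))
  then have "surj ?M"
    using linear_injective_imp_surjective[OF has_derivative_linear[OF M]] by simp
  then obtain \<xi> where "\<zeta> = ?M \<xi>" by (rule surjE)
  then show ?thesis
    by (simp add: w)
qed

text \<open>Passes equivariance from two connections to their difference.\<close>

lemma Ad_diff:
  assumes "g \<in> carrier isom_nil"
  shows "Ad g (\<xi> - \<eta>) = Ad g \<xi> - Ad g \<eta>"
proof -
  obtain w t u where "g = ((w, t), u)" "cmod u = 1"
    using assms by (auto simp: isom_nil_def)
  then show ?thesis
    by (cases \<xi>; cases \<eta>) (simp add: Ad_eq Let_def algebra_simps diff_divide_distrib)
qed

text \<open>Curvature is natural: both the exterior derivative and the bracket of values commute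
  with pullback along \<open>s\<close>.\<close>

lemma pullback_flat:
  fixes A :: "('m::topological_space, 'e::euclidean_space) chart set"
    and B :: "('p, 'f::euclidean_space) chart set"
  assumes A: "smooth_manifold A" and s: "smooth_map A B s" and c: "c \<in> A" "x \<in> fst c"
    and d: "d \<in> B" "s x \<in> fst d" "open (snd d ` fst d)"
    and conn: "flat_connection B act \<omega>" and \<alpha>: "is_pullback1 A B s \<omega> \<alpha>"
  shows "(\<lambda>y. \<alpha> c y v) differentiable (at (snd c x))" and "curvature \<alpha> c (snd c x) v w = 0"
proof -
  let ?S = "snd c ` (fst c \<inter> s -` fst d)" and ?F = "local_rep c d s"
  have F: "C_infinity_on ?S ?F" and S: "open ?S" "snd c x \<in> ?S"
    using s c d unfolding smooth_map_def by auto
  have form: "one_form B \<omega>"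
    using conn unfolding flat_connection_def principal_connection_def by blast
  have rep: "?F (snd c x') = snd d (s x')" if "x' \<in> fst c" for x'
    using local_rep_chart[OF A c(1) that] .
  have T: "?F y \<in> snd d ` fst d" if "y \<in> ?S" for y
    using that rep by auto
  have lin: "linear (\<omega> d z)" if "z \<in> snd d ` fst d" for z
    using form d(1) that unfolding one_form_def by blast
  have diff: "(\<lambda>z. \<omega> d z b) differentiable (at (?F (snd c x)))" for b
    using form d(1) T[OF S(2)] C_infinity_on_differentiable unfolding one_form_def by blast
  have eq: "\<alpha> c y v = \<omega> d (?F y) (frechet_derivative ?F (at y) v)" if "y \<in> ?S" for y v
    using that \<alpha> c(1) d(1) rep unfolding is_pullback1_def coord_deriv_def by auto
  note pb = F S d(3) T lin diff eq
  show "(\<lambda>y. \<alpha> c y v) differentiable (at (snd c x))"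
    by (rule differentiable_pullback[where F = ?F and y = "snd c x" and \<omega> = \<omega> and d = d and \<alpha> = \<alpha> and c = c, OF pb])
  have "ext_d1 \<alpha> c (snd c x) v w = ext_d1 \<omega> d (?F (snd c x))
      (frechet_derivative ?F (at (snd c x)) v) (frechet_derivative ?F (at (snd c x)) w)"
    by (rule ext_d1_pullback[where F = ?F and y = "snd c x" and \<omega> = \<omega> and d = d and \<alpha> = \<alpha> and c = c, OF pb])
  then have "curvature \<alpha> c (snd c x) v w = curvature \<omega> d (snd d (s x))
      (frechet_derivative ?F (at (snd c x)) v) (frechet_derivative ?F (at (snd c x)) w)"
    unfolding curvature_eq eq[OF S(2)] rep[OF c(2)] by (rule arg_cong)
  then show "curvature \<alpha> c (snd c x) v w = 0"
    using conn d(1,2) unfolding flat_connection_def by simp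
qed

text \<open>The difference is horizontal and equivariant, hence determined by its pullback along
  \<open>s\<close>. The chart \<open>d'\<close> around the section value is returned for pulling
  back curvature.\<close>

lemma flat_difference_equivariant:
  fixes A :: "('m::topological_space, 'e::euclidean_space) chart set"
  assumes A: "smooth_manifold A" and \<rho>: "\<rho> \<in> hom (fundamental_group x0) isom_nil"
    and triv: "flat_bundle_trivial A x0 \<rho>" and s: "smooth_section A x0 \<rho> s"
    and conn: "principal_connection (flat_atlas A x0 \<rho>) flat_act \<omega>"
      "principal_connection (flat_atlas A x0 \<rho>) flat_act \<tau>"
    and \<alpha>: "is_pullback1 A (flat_atlas A x0 \<rho>) s (form1_diff \<omega> \<tau>) \<alpha>"
    and d: "d \<in> flat_atlas A x0 \<rho>" "u \<in> fst d" and c: "c \<in> A" "flat_proj u \<in> fst c"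
  obtains k d' where "k \<in> carrier isom_nil" "d' \<in> flat_atlas A x0 \<rho>" "s (flat_proj u) \<in> fst d'"
    "open (snd d' ` fst d')"
    "\<And>v. form1_diff \<omega> \<tau> d (snd d u) v =
      Ad k (\<alpha> c (snd c (flat_proj u)) (coord_deriv d c flat_proj u v))"
proof -
  interpret group isom_nil by (rule group_isom_nil)
  let ?B = "flat_atlas A x0 \<rho>" and ?x = "flat_proj u"
  obtain U V \<phi> \<sigma> h where V: "(V, \<phi>) \<in> A" "U \<subseteq> V" "open U" and chart: "flat_chart x0 \<rho> d U \<phi> \<sigma> h"
    and translates: "\<And>k. k \<in> carrier isom_nil \<Longrightarrow> \<exists>d'\<in>?B. flat_chart x0 \<rho> d' U \<phi> \<sigma> (h \<otimes>\<^bsub>isom_nil\<^esub> k)"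
    using flat_atlas_chart[OF A \<rho> d(1)] by metis
  note cd = flat_chart_param[OF chart]
  note man = manifold_chart[OF A V(1)]
  have inj: "inj_on \<phi> U"
    using man(1) V(2) by (rule inj_on_subset)
  obtain \<eta>0 where x: "?x \<in> U" "\<eta>0 \<in> strip"
      and u: "u = orbit x0 \<rho> (\<sigma> ?x) (h \<otimes>\<^bsub>isom_nil\<^esub> isonil_param \<eta>0)"
    using cd(6)[OF d(2)] flat_chart_proj(1)[OF chart] by metis
  have "s ?x \<in> flat_bundle x0 \<rho>" "flat_proj (s ?x) = ?x" "smooth_map A ?B s"
    using s unfolding smooth_section_def by auto
  moreover have "u \<in> flat_bundle x0 \<rho>"
    using flat_chart_proj(2)[OF chart x(1)] u by metis
  \<comment> \<open>Here \<open>u\<close> is the section value moved by the inverse of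
    \<open>k\<close>, so the equivariance law yields \<open>Ad k\<close>.\<close>
  ultimately obtain k where k: "k \<in> carrier isom_nil" "s ?x = flat_act u k"
      "u = flat_act (s ?x) (inv\<^bsub>isom_nil\<^esub> k)"
    using flat_bundle_orbits[OF triv, of u "s ?x"] by metis
  let ?k' = "inv\<^bsub>isom_nil\<^esub> k"
  have k': "?k' \<in> carrier isom_nil" using k(1) by simp
  \<comment> \<open>From this translated chart to \<open>d\<close>, right translation by
    \<open>?k'\<close> fixes the base coordinate and acts as \<open>conj_coord k\<close> on the
    fibre.\<close>
  obtain d' where d': "d' \<in> ?B" and chart': "flat_chart x0 \<rho> d' U \<phi> \<sigma> (h \<otimes>\<^bsub>isom_nil\<^esub> k)"
    using translates[OF k(1)] by blast
  note cd' = flat_chart_param[OF chart']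
  \<comment> \<open>The fibre coordinate of \<open>s ?x\<close> in \<open>d'\<close>: moving
    \<open>k\<close> to the left past \<open>isonil_param \<eta>0\<close> conjugates the latter by
    \<open>?k'\<close>.\<close>
  let ?\<eta>1 = "conj_coord ?k' \<eta>0"
  have \<eta>1: "?\<eta>1 \<in> strip"
    by (rule conj_coord_strip[OF x(2)])
  have "h \<otimes>\<^bsub>isom_nil\<^esub> isonil_param \<eta>0 \<otimes>\<^bsub>isom_nil\<^esub> k =
      h \<otimes>\<^bsub>isom_nil\<^esub> k \<otimes>\<^bsub>isom_nil\<^esub> isonil_param ?\<eta>1"
  proof -
    have "k \<otimes>\<^bsub>isom_nil\<^esub> (?k' \<otimes>\<^bsub>isom_nil\<^esub> g) = g" if "g \<in> carrier isom_nil" for g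
      using k(1) that by (simp add: m_assoc[symmetric])
    then have "h \<otimes>\<^bsub>isom_nil\<^esub> k \<otimes>\<^bsub>isom_nil\<^esub> (?k' \<otimes>\<^bsub>isom_nil\<^esub> isonil_param \<eta>0 \<otimes>\<^bsub>isom_nil\<^esub> k) =
        h \<otimes>\<^bsub>isom_nil\<^esub> isonil_param \<eta>0 \<otimes>\<^bsub>isom_nil\<^esub> k"
      using cd(1) k(1) by (simp add: m_assoc isonil_param_closed del: isonil_param.simps)
    then show ?thesis
      using cd(1) k(1) conj_isonil_param[OF k', of \<eta>0] by (simp del: isonil_param.simps)
  qed
  then have "flat_act u k = orbit x0 \<rho> (\<sigma> ?x) (h \<otimes>\<^bsub>isom_nil\<^esub> k \<otimes>\<^bsub>isom_nil\<^esub> isonil_param ?\<eta>1)"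
    using flat_act_orbit[OF \<rho> cd(2)[OF x(1)] m_closed[OF cd(1) isonil_param_closed] k(1), of \<eta>0] u
    by metis
  then have sx: "s ?x \<in> fst d'" "snd d' (s ?x) = (\<phi> ?x, ?\<eta>1)"
    using cd'(4,5)[OF x(1) \<eta>1] k(2) by simp_all
  have su: "snd d u = (\<phi> ?x, \<eta>0)"
    using cd(5)[OF x] u by metis
  \<comment> \<open>The section, the right translation and the projection in coordinates;
    \<open>?T\<close> is the change of base coordinates through which \<open>?P\<close>
    factors.\<close>
  let ?F = "local_rep c d' s" and ?R = "local_rep d' d (\<lambda>u. flat_act u ?k')" and ?P = "local_rep d c flat_proj"
  let ?T = "local_rep (V, \<phi>) c id"
  let ?y = "snd c ?x" and ?S = "snd c ` (fst c \<inter> s -` fst d')"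
  have R: "?R (\<phi> x, \<eta>) = (\<phi> x, conj_coord k \<eta>)" if "x \<in> U" "\<eta> \<in> strip" for x \<eta>
  proof -
    have "flat_act (orbit x0 \<rho> (\<sigma> x) (h \<otimes>\<^bsub>isom_nil\<^esub> k \<otimes>\<^bsub>isom_nil\<^esub> isonil_param \<eta>)) ?k' =
        orbit x0 \<rho> (\<sigma> x) (h \<otimes>\<^bsub>isom_nil\<^esub> k \<otimes>\<^bsub>isom_nil\<^esub> isonil_param \<eta> \<otimes>\<^bsub>isom_nil\<^esub> ?k')"
      by (rule flat_act_orbit[OF \<rho> cd(2)[OF that(1)] m_closed[OF cd'(1) isonil_param_closed] k'])
    also have "h \<otimes>\<^bsub>isom_nil\<^esub> k \<otimes>\<^bsub>isom_nil\<^esub> isonil_param \<eta> \<otimes>\<^bsub>isom_nil\<^esub> ?k' =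
        h \<otimes>\<^bsub>isom_nil\<^esub> isonil_param (conj_coord k \<eta>)"
      unfolding conj_isonil_param[OF k(1), symmetric]
      using cd(1) k(1) by (simp add: m_assoc isonil_param_closed del: isonil_param.simps)
    finally show ?thesis
      unfolding local_rep_def o_def flat_chart_inverse[OF chart' inj that]
      using cd(5)[OF that(1) conj_coord_strip[OF that(2)]] by metis
  qed
  have P: "?P (\<phi> x, \<eta>) = snd c x" "?T (\<phi> x) = snd c x" if "x \<in> U" "\<eta> \<in> strip" for x \<eta>
    using flat_chart_inverse[OF chart inj that] flat_chart_proj(1)[OF chart that(1), of \<eta>]
      the_inv_into_f_f[OF man(1), of x] that V(2) by (auto simp: local_rep_def)
  have DR: "(?R has_derivative (\<lambda>w. (fst w, frechet_derivative (conj_coord k) (at ?\<eta>1) (snd w))))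
      (at (\<phi> ?x, ?\<eta>1))"
  proof (rule has_derivative_transform_within_open)
    have "(conj_coord k has_derivative frechet_derivative (conj_coord k) (at ?\<eta>1)) (at (snd (\<phi> ?x, ?\<eta>1)))"
      unfolding snd_conv by (rule differentiable_conj_coord[THEN frechet_derivative_works[THEN iffD1]])
    from has_derivative_compose[OF has_derivative_snd[OF has_derivative_ident] this]
    show "((\<lambda>w. (fst w, conj_coord k (snd w))) has_derivative
        (\<lambda>w. (fst w, frechet_derivative (conj_coord k) (at ?\<eta>1) (snd w)))) (at (\<phi> ?x, ?\<eta>1))"
      by (intro has_derivative_Pair has_derivative_fst has_derivative_ident)
    show "open (\<phi> ` U \<times> strip)"
      by (intro open_Times man(3) V open_strip)
  qed (use x(1) \<eta>1 R in auto)
  let ?C = "frechet_derivative ?T (at (\<phi> ?x))"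
  have "C_infinity_on (\<phi> ` (V \<inter> fst c)) ?T"
    using A V(1) c(1) unfolding smooth_manifold_def by fastforce
  then have DT: "(?T has_derivative ?C) (at (\<phi> ?x))"
    by (rule C_infinity_on_has_derivative) (use x(1) V(2) c(2) in auto)
  have DP: "(?P has_derivative (\<lambda>w. ?C (fst w))) (at (\<phi> ?x, \<eta>))" if "\<eta> \<in> strip" for \<eta>
  proof (rule has_derivative_transform_within_open)
    have "(?T has_derivative ?C) (at (fst (\<phi> ?x, \<eta>)))"
      unfolding fst_conv by (rule DT)
    then show "((\<lambda>w. ?T (fst w)) has_derivative (\<lambda>w. ?C (fst w))) (at (\<phi> ?x, \<eta>))"
      by (rule has_derivative_compose[OF has_derivative_fst[OF has_derivative_ident]])
    have "open (fst c)"
      using manifold_chart(2)[OF A, of "fst c" "snd c"] c(1) by simp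
    then show "open (\<phi> ` (U \<inter> fst c) \<times> strip)"
      using V by (intro open_Times man(3) open_strip open_Int) auto
  qed (use x(1) c(2) that P in auto)
  have F: "?F (snd c x') = snd d' (s x')" if "x' \<in> fst c" for x'
    by (rule local_rep_chart[OF A c(1) that])
  have smooth_s: "smooth_map A ?B s" and proj_s: "\<And>x. flat_proj (s x) = x"
    using s unfolding smooth_section_def by auto
  have S: "open ?S" "?y \<in> ?S" and smooth_F: "C_infinity_on ?S ?F"
    using smooth_s c d' sx(1) unfolding smooth_map_def by auto
  let ?DF = "frechet_derivative ?F (at ?y)"
  have DF: "(?F has_derivative ?DF) (at ?y)"
    by (rule C_infinity_on_has_derivative[OF smooth_F S(2)])
  \<comment> \<open>Translation along the fibre does not change the projection, which inverts the
    section.\<close>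
  have inverse: "?P (?R (?F y)) = y" if y: "y \<in> ?S" for y
  proof -
    obtain x' where x': "x' \<in> fst c" "s x' \<in> fst d'" "y = snd c x'"
      using y by blast
    obtain x'' \<eta> where *: "x'' \<in> U" "\<eta> \<in> strip"
        "s x' = orbit x0 \<rho> (\<sigma> x'') (h \<otimes>\<^bsub>isom_nil\<^esub> k \<otimes>\<^bsub>isom_nil\<^esub> isonil_param \<eta>)"
      using cd'(6)[OF x'(2)] by blast
    have "x'' = x'"
      using flat_chart_proj(1)[OF chart' *(1), of \<eta>] proj_s[of x'] *(3) by metis
    then have "?F y = (\<phi> x', \<eta>)"
      using F[OF x'(1)] cd'(5)[OF *(1,2)] *(3) x'(3) by metis
    then show ?thesis
      using R[OF *(1,2)] P(1)[OF *(1) conj_coord_strip[OF *(2)]] \<open>x'' = x'\<close> x'(3) by simp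
  qed
  have "((\<lambda>y. ?P (?R (?F y))) has_derivative (\<lambda>w. ?C (fst (?DF w)))) (at ?y)"
  proof -
    have DR': "(?R has_derivative (\<lambda>w. (fst w, frechet_derivative (conj_coord k) (at ?\<eta>1) (snd w)))) (at (?F ?y))"
      using DR unfolding F[OF c(2)] sx(2) .
    have DP': "(?P has_derivative (\<lambda>w. ?C (fst w))) (at (?R (?F ?y)))"
      unfolding F[OF c(2)] sx(2) R[OF x(1) \<eta>1] by (rule DP[OF conj_coord_strip[OF \<eta>1]])
    show ?thesis
      using has_derivative_compose[OF has_derivative_compose[OF DF DR'] DP'] by simp
  qed
  \<comment> \<open>Differentiating the identity makes the endomorphism \<open>?C\<close>
    surjective, hence injective: a projected vector determines the base component.\<close>
  then have "((\<lambda>y. y) has_derivative (\<lambda>w. ?C (fst (?DF w)))) (at ?y)"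
    by (rule has_derivative_transform_within_open[OF _ S inverse])
  then have "(\<lambda>w. ?C (fst (?DF w))) = (\<lambda>w. w)"
    by (rule has_derivative_unique[OF _ has_derivative_ident])
  then have CF: "?C (fst (?DF w)) = w" for w
    by (rule fun_cong)
  have dP: "coord_deriv d c flat_proj u = (\<lambda>w. ?C (fst w))"
    unfolding coord_deriv_def su by (rule frechet_derivative_at[OF DP[OF x(2)], symmetric])
  have dR: "coord_deriv d' d (\<lambda>u. flat_act u ?k') (s ?x) =
      (\<lambda>w. (fst w, frechet_derivative (conj_coord k) (at ?\<eta>1) (snd w)))"
    unfolding coord_deriv_def sx(2) by (rule frechet_derivative_at[OF DR, symmetric])
  have equiv: "form1_diff \<omega> \<tau> d (snd d u) (coord_deriv d' d (\<lambda>u. flat_act u ?k') (s ?x) w) =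
      Ad k (form1_diff \<omega> \<tau> d' (snd d' (s ?x)) w)" for w
  proof -
    have e: "Ad (inv\<^bsub>isom_nil\<^esub> ?k') (\<theta> d' (snd d' (s ?x)) w) =
        \<theta> d (snd d u) (coord_deriv d' d (\<lambda>u. flat_act u ?k') (s ?x) w)"
      if "principal_connection ?B flat_act \<theta>" for \<theta>
    proof -
      have "is_pullback1 ?B ?B (\<lambda>u. flat_act u ?k') \<theta> (\<lambda>d y v. Ad (inv\<^bsub>isom_nil\<^esub> ?k') (\<theta> d y v))"
        using that k' unfolding principal_connection_def by blast
      moreover have "s ?x \<in> fst d' \<inter> (\<lambda>u. flat_act u ?k') -` fst d"
        using sx(1) d(2) k(3) by simp
      ultimately have "Ad (inv\<^bsub>isom_nil\<^esub> ?k') (\<theta> d' (snd d' (s ?x)) w) =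
          \<theta> d (snd d (flat_act (s ?x) ?k')) (coord_deriv d' d (\<lambda>u. flat_act u ?k') (s ?x) w)"
        using d' d(1) unfolding is_pullback1_def by blast
      then show ?thesis
        unfolding k(3)[symmetric] .
    qed
    show ?thesis
      using e[OF conn(1)] e[OF conn(2)] k(1) unfolding form1_diff_def by (simp add: Ad_diff)
  qed
  have lin: "linear (form1_diff \<omega> \<tau> d (snd d u))"
  proof -
    have "linear (\<omega> d (snd d u))" "linear (\<tau> d (snd d u))"
      using conn d unfolding principal_connection_def one_form_def by blast+
    then show ?thesis
      unfolding form1_diff_def by (rule linear_compose_sub)
  qed
  have "form1_diff \<omega> \<tau> d (snd d u) v =
      Ad k (\<alpha> c ?y (coord_deriv d c flat_proj u v))" for v
  proof -
    let ?w = "coord_deriv d c flat_proj u v"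
    \<comment> \<open>The projected vector is lifted by the section and translated to
      \<open>u\<close>. This lift differs from \<open>v\<close> by a vertical vector, on which the
      two connections agree.\<close>
    let ?v = "coord_deriv d' d (\<lambda>u. flat_act u ?k') (s ?x) (?DF ?w)"
    have "linear ?C"
      by (rule has_derivative_linear[OF DT])
    moreover have "surj ?C"
      using CF by (rule surjI)
    ultimately have "inj ?C"
      by (rule linear_surjective_imp_injective) simp
    moreover have "?C (fst v) = ?C (fst ?v)"
      using CF[of ?w] unfolding dR dP by simp
    ultimately have "fst v = fst ?v"
      by (rule injD)
    then have "v = ?v + (0, snd v - snd ?v)"
      by (simp add: prod_eq_iff)
    moreover have "form1_diff \<omega> \<tau> d (snd d u) (0, snd v - snd ?v) = 0"
      using connection_vertical[OF \<rho> chart d(1,2) conn] by (simp add: form1_diff_def)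
    ultimately have "form1_diff \<omega> \<tau> d (snd d u) v = form1_diff \<omega> \<tau> d (snd d u) ?v"
      using linear_add[OF lin, of ?v "(0, snd v - snd ?v)"] by simp
    also have "\<dots> = Ad k (form1_diff \<omega> \<tau> d' (snd d' (s ?x)) (?DF ?w))"
      by (rule equiv)
    also have "form1_diff \<omega> \<tau> d' (snd d' (s ?x)) (?DF ?w) = \<alpha> c ?y ?w"
      using \<alpha> c d' sx(1) unfolding is_pullback1_def coord_deriv_def by auto
    finally show ?thesis .
  qed
  moreover have "open (snd d' ` fst d')"
    unfolding flat_chart_range[OF chart'] by (intro open_Times man(3) V open_strip)
  ultimately show thesis
    using that[OF k(1) d' sx(1)] by blast
qed

theorem proposition3p1:
  fixes A :: "('m::{t2_space, second_countable_topology}, real ^ 3) chart set"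
    and x0 :: 'm
    and \<rho> :: "(real \<Rightarrow> 'm) set \<Rightarrow> isonil"
    and s :: "'m \<Rightarrow> 'm flat_pt"
    and \<omega>_flat \<omega>_triv :: "('m flat_pt, (real ^ 3) \<times> lie, lie) form1"
    and a_X a_Y a_Z a_R :: "('m, real ^ 3, real) form1"
    and c1 c2 :: real
  assumes "smooth_manifold A" and "oriented_atlas A"
    and "connected (UNIV :: 'm set)" and "compact (UNIV :: 'm set)"
    and "\<rho> \<in> hom (fundamental_group x0) isom_nil"
    and "flat_bundle_trivial A x0 \<rho>"
    and "smooth_section A x0 \<rho> s"
    and "is_trivial_connection A (flat_atlas A x0 \<rho>) flat_act s \<omega>_triv"
    and "flat_connection (flat_atlas A x0 \<rho>) flat_act \<omega>_flat"
    and "is_pullback1 A (flat_atlas A x0 \<rho>) s (form1_diff \<omega>_flat \<omega>_triv)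
           (\<lambda>c y v. a_X c y v *\<^sub>R lie_X + a_Y c y v *\<^sub>R lie_Y + a_Z c y v *\<^sub>R lie_Z + a_R c y v *\<^sub>R lie_R)"
  shows "is_CS_form A (flat_atlas A x0 \<rho>) flat_proj (inv_poly c1 c2) \<omega>_flat \<omega>_triv
           (\<lambda>c y v1 v2 v3. c1 * ext_d2 (wedge11 (*) a_Z a_R) c y v1 v2 v3)"
  unfolding is_CS_form_def is_pullback3_def
proof (intro ballI allI)
  let ?B = "flat_atlas A x0 \<rho>" and ?a = "form1_diff \<omega>_flat \<omega>_triv"
  let ?\<alpha> = "\<lambda>c y v. a_X c y v *\<^sub>R lie_X + a_Y c y v *\<^sub>R lie_Y + a_Z c y v *\<^sub>R lie_Z + a_R c y v *\<^sub>R lie_R"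
  fix d c u v1 v2 v3
  assume d: "d \<in> ?B" and c: "c \<in> A" and u: "u \<in> fst d \<inter> flat_proj -` fst c"
  let ?x = "flat_proj u"
  let ?D = "coord_deriv d c flat_proj u"
  have triv: "flat_connection ?B flat_act \<omega>_triv" "is_pullback1 A ?B s \<omega>_triv (\<lambda>c y v. 0)"
    using assms(8) unfolding is_trivial_connection_def by blast+
  have conn: "principal_connection ?B flat_act \<omega>_flat" "principal_connection ?B flat_act \<omega>_triv"
    using assms(9) triv(1) unfolding flat_connection_def by blast+
  obtain k d' where k: "k \<in> carrier isom_nil" and d': "d' \<in> ?B" "s ?x \<in> fst d'" "open (snd d' ` fst d')"
    and a: "\<And>v. ?a d (snd d u) v = Ad k (?\<alpha> c (snd c ?x) (?D v))"
    using flat_difference_equivariant[OF assms(1,5,6,7) conn assms(10) d _ c] u by blast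
  \<comment> \<open>The trivial connection pulls back to zero along \<open>s\<close>, so
    \<open>?\<alpha>\<close> is the pullback of \<open>\<omega>_flat\<close> alone and inherits its
    flatness.\<close>
  have \<alpha>: "is_pullback1 A ?B s \<omega>_flat ?\<alpha>"
    using assms(10) triv(2) unfolding is_pullback1_def form1_diff_def by simp
  have "smooth_map A ?B s"
    using assms(7) unfolding smooth_section_def by blast
  note flat = pullback_flat[OF assms(1) this c _ d' assms(9) \<alpha>]
  have diff: "(\<lambda>y. \<omega> d y v) differentiable (at (snd d u))" if "principal_connection ?B flat_act \<omega>" for \<omega> v
    using that d u C_infinity_on_differentiable unfolding principal_connection_def one_form_def by blast
  have "CS_upstairs (inv_poly c1 c2) \<omega>_flat \<omega>_triv d (snd d u) v1 v2 v3 =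
      - inv_poly c1 c2 (?a d (snd d u) v1) (lie_bracket (?a d (snd d u) v2) (?a d (snd d u) v3))"
    by (rule CS_upstairs_flat) (use diff conn assms(9) triv(1) d u in \<open>auto simp: flat_connection_def\<close>)
  also have "\<dots> = - inv_poly c1 c2 (?\<alpha> c (snd c ?x) (?D v1))
      (lie_bracket (?\<alpha> c (snd c ?x) (?D v2)) (?\<alpha> c (snd c ?x) (?D v3)))"
    unfolding a inv_poly_bracket_Ad[OF k] ..
  also have "\<dots> = c1 * ext_d2 (wedge11 (*) a_Z a_R) c (snd c ?x) (?D v1) (?D v2) (?D v3)"
    by (rule ext_d2_wedge_flat[symmetric]) (use flat u in auto)
  finally show "CS_upstairs (inv_poly c1 c2) \<omega>_flat \<omega>_triv d (snd d u) v1 v2 v3 =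
      c1 * ext_d2 (wedge11 (*) a_Z a_R) c (snd c ?x) (?D v1) (?D v2) (?D v3)" .
qed

end
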